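(* For every partition $\lambda$ and every finite sequence of partitions $R=(R_1,\dots,R_L)$, the polynomial $d^{\diamondsuit}_{\lambda R}(t)$ does not depend on $\diamondsuit\in\{\square,\mathrm{v},\mathrm{h}\}$; that is, $d^{\square}_{\lambda R}(t)=d^{\mathrm{v}}_{\lambda R}(t)=d^{\mathrm{h}}_{\lambda R}(t)$.
   Context: $\Lambda$ is the ring of symmetric functions in $X=x_1+x_2+\cdots$ (rational coefficients, extended by auxiliary indeterminates as needed), with the scalar product for which Schur functions are orthonormal. Plethystic notation: $P[A]$ is obtained from $P\in\Lambda$ by expressing $P$ in power sums and replacing $p_k$ by $p_k[A]$, where $p_k[A]$ raises every indeterminate in $A$ (including $t$) to the $k$-th power and $p_k[A-B]=p_k[A]-p_k[B]$; $\Omega[A]=\exp(\sum_{k\ge1}p_k[A]/k)$. $P^\perp$ is the operator adjoint to multiplication by $P$ (in the $X$ variables); in particular $\Omega[XA]^\perp P[X]=P[X+A]$. The symbols: $\square$ (single cell), $\mathrm{h}$ (horizontal domino), $\mathrm{v}$ (vertical domino). Put $f_\square=s_1+s_{(1^2)}$, $f_{\mathrm{h}}=s_2$, $f_{\mathrm{v}}=s_{(1^2)}$, and let $s^\diamondsuit_\lambda=\Omega[-f_\diamondsuit]^\perp s_\lambda$ for partitions $\lambda$; $\{s^\diamondsuit_\lambda\}$ is a basis of $\Lambda$. Bernstein's operators $B_r\in\mathrm{End}(\Lambda)$ are defined by $\sum_{r\in\mathbb{Z}}B_rz^r=\Omega[zX]\,\Omega[-z^{-1}X]^\perp$ (skew,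 then multiply). For $\nu\in\mathbb{Z}^n$, $B_\nu=B_{\nu_1}\circ\cdots\circ B_{\nu_n}$ and $B^\diamondsuit_\nu=\Omega[-f_\diamondsuit]^\perp\circ B_\nu\circ\Omega[f_\diamondsuit]^\perp$. The $t$-analogue of $V\in\mathrm{End}(\Lambda)$ is $\widetilde V(P[X])=V^Y(P[tX+(1-t)Y])|_{Y\to X}$, where $V^Y$ is $V$ acting in a second set of variables $Y$ and afterwards $Y$ is replaced by $X$. Let $\widetilde B^\diamondsuit_\nu$ be the $t$-analogue of $B^\diamondsuit_\nu$. A partition $R_j$ with $\ell(R_j)$ (nonzero) parts is regarded as an element of $\mathbb{Z}^{\ell(R_j)}$, and $d^\diamondsuit_{\lambda R}(t)$ is defined by $$\widetilde B^\diamondsuit_{R_1}\widetilde B^\diamondsuit_{R_2}\cdots\widetilde B^\diamondsuit_{R_L}\,1=\sum_\lambda d^\diamondsuit_{\lambda R}(t)\,s^\diamondsuit_\lambda .$$ *)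

theory Defs
  imports
    "HOL-Library.Poly_Mapping"
    "HOL-Library.Groups_Big_Fun"
    "HOL-Computational_Algebra.Polynomial"
    "HOL-Computational_Algebra.Formal_Power_Series"
    "Jordan_Normal_Form.Determinant"
begin

subsection \<open>Symmetric functions and plethysm\<close>

text \<open>
  Symmetric functions with coefficients in \<open>\<rat>[t]\<close> are written, as plethystic notation requires,
  as polynomials in the power sums: the ring \<open>\<Lambda>\<close> is the polynomial ring \<open>\<rat>[t][p\<^sub>1, p\<^sub>2, \<dots>]\<close>.
  The variable with index \<open>i\<close> is \<open>p\<^sub>i\<^sub>+\<^sub>1\<close> (so there is no \<open>p\<^sub>0\<close>), and a monomial is its
  finitely supported exponent function.
\<close>

type_synonym symf = "(nat \<Rightarrow>\<^sub>0 nat) \<Rightarrow>\<^sub>0 rat poly"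

definition cst :: "'c::zero \<Rightarrow> (nat \<Rightarrow>\<^sub>0 nat) \<Rightarrow>\<^sub>0 'c" where
  "cst c = Poly_Mapping.single 0 c"

definition pmono :: "(nat \<Rightarrow>\<^sub>0 nat) \<Rightarrow> (nat \<Rightarrow>\<^sub>0 nat) \<Rightarrow>\<^sub>0 'c::zero_neq_one" where
  "pmono m = Poly_Mapping.single m 1"

definition psum :: "nat \<Rightarrow> (nat \<Rightarrow>\<^sub>0 nat) \<Rightarrow>\<^sub>0 'c::zero_neq_one" where
  "psum k = pmono (Poly_Mapping.single (k - 1) 1)"

abbreviation tvar :: "rat poly" where
  "tvar \<equiv> Polynomial.monom 1 1"

text \<open>
  \<open>psubst \<phi> a P\<close> replaces each \<open>p\<^sub>k\<close> in \<open>P\<close> by \<open>a k\<close> and each coefficient \<open>c\<close> by \<open>\<phi> c\<close>.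
  For \<open>\<phi>\<close> the inclusion of the coefficients and \<open>a k = p\<^sub>k[A]\<close> this is \<open>P[A]\<close>.
\<close>

definition psubst ::
  "('c::zero \<Rightarrow> 'b::comm_ring_1) \<Rightarrow> (nat \<Rightarrow> 'b) \<Rightarrow> ((nat \<Rightarrow>\<^sub>0 nat) \<Rightarrow>\<^sub>0 'c) \<Rightarrow> 'b" where
  "psubst \<phi> a P =
    (\<Sum>m\<in>Poly_Mapping.keys P. \<phi> (Poly_Mapping.lookup P m) *
      (\<Prod>i\<in>Poly_Mapping.keys m. a (Suc i) ^ Poly_Mapping.lookup m i))"

text \<open>
  \<open>p\<^sub>k[A]\<close> for \<open>A \<in> \<Lambda>\<close>: all indeterminates, including \<open>t\<close>, are raised to the \<open>k\<close>-th power;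
  on \<open>X\<close> this sends \<open>p\<^sub>j\<close> to \<open>p\<^sub>j\<^sub>k\<close>.
\<close>

definition adams :: "nat \<Rightarrow> symf \<Rightarrow> symf" where
  "adams k = psubst (\<lambda>c. cst (pcompose c (Polynomial.monom 1 k))) (\<lambda>j. psum (j * k))"

text \<open>\<open>p\<^sub>k[A]\<close> for \<open>A \<in> \<Lambda>[[z]]\<close>, with \<open>z\<close> a further indeterminate.\<close>

definition adams_fps :: "nat \<Rightarrow> symf fps \<Rightarrow> symf fps" where
  "adams_fps k A = Abs_fps (\<lambda>n. if k dvd n then adams k (fps_nth A (n div k)) else 0)"

text \<open>
  \<open>\<Omega>[A] = exp (\<Sum>k\<ge>1. p\<^sub>k[A] / k)\<close> for \<open>A \<in> \<Lambda>[[z]]\<close> without constant term in \<open>z\<close>. The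
  terms with \<open>k > n\<close> do not contribute to the coefficient of \<open>z\<^sup>n\<close> of the sum.
\<close>

definition Omega :: "symf fps \<Rightarrow> symf fps" where
  "Omega A =
    fps_compose (Abs_fps (\<lambda>n. cst [:1 / fact n:]))
      (Abs_fps (\<lambda>n. \<Sum>k=1..n. cst [:1 / of_nat k:] * fps_nth (adams_fps k A) n))"

text \<open>\<open>P[zX]\<close>; the coefficient of \<open>z\<^sup>n\<close> is the component of \<open>P\<close> of degree \<open>n\<close>.\<close>

definition graded :: "symf \<Rightarrow> symf fps" where
  "graded = psubst (\<lambda>c. fps_const (cst c)) (\<lambda>k. fps_const (psum k) * fps_X ^ k)"

subsection \<open>Schur functions and the scalar product\<close>

text \<open>The complete symmetric functions \<open>h\<^sub>r\<close>: \<open>\<Omega>[zX] = \<Sum>r. h\<^sub>r z\<^sup>r\<close>, and \<open>h\<^sub>r = 0\<close> for \<open>r < 0\<close>.\<close>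

definition hsym :: "int \<Rightarrow> symf" where
  "hsym r = (if r < 0 then 0 else fps_nth (Omega (fps_X * fps_const (psum 1))) (nat r))"

definition is_partition :: "nat list \<Rightarrow> bool" where
  "is_partition lam \<longleftrightarrow> sorted_wrt (\<ge>) lam \<and> 0 \<notin> set lam"

definition schur :: "nat list \<Rightarrow> symf" where
  "schur lam =
    Determinant.det (mat (length lam) (length lam) (\<lambda>(i, j). hsym (int (lam ! i) - int i + int j)))"

text \<open>
  The coefficients of \<open>P\<close> in a basis \<open>b\<close> of \<open>\<Lambda>\<close> indexed by partitions (meaningful only if
  \<open>b\<close> is a basis).
\<close>

definition coords :: "(nat list \<Rightarrow> symf) \<Rightarrow> symf \<Rightarrow> (nat list \<Rightarrow>\<^sub>0 rat poly)" where
  "coords b P = (THE c. Poly_Mapping.keys c \<subseteq> Collect is_partition \<and>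
    P = (\<Sum>lam\<in>Poly_Mapping.keys c. cst (Poly_Mapping.lookup c lam) * b lam))"

text \<open>The bilinear form for which the Schur functions are orthonormal.\<close>

definition scalar_product :: "symf \<Rightarrow> symf \<Rightarrow> rat poly" where
  "scalar_product P Q = (\<Sum>lam\<in>Poly_Mapping.keys (coords schur P).
    Poly_Mapping.lookup (coords schur P) lam * Poly_Mapping.lookup (coords schur Q) lam)"

definition perp :: "symf \<Rightarrow> symf \<Rightarrow> symf" where
  "perp P Q = (THE Q'. \<forall>S. scalar_product S Q' = scalar_product (P * S) Q)"

text \<open>
  \<open>\<Omega>[f]\<close> lies in the completion of \<open>\<Lambda>\<close>, and \<open>\<Omega>[f]\<^sup>\<bottom>\<close> is the sum of the operators adjoint to its
  homogeneous components. Only finitely many of these do not annihilate a given \<open>P\<close>, so the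
  sum over the nonzero terms is the whole sum. The constant term of \<open>f\<close> is assumed to be \<open>0\<close>.
\<close>

definition Omega_perp :: "symf \<Rightarrow> symf \<Rightarrow> symf" where
  "Omega_perp f P = Sum_any (\<lambda>n. perp (fps_nth (Omega (graded f)) n) P)"

subsection \<open>Bernstein operators, their deformations and their analogues\<close>

text \<open>
  The coefficient of \<open>z\<^sup>r\<close> in \<open>\<Omega>[zX] \<Omega>[-z\<^sup>-\<^sup>1X]\<^sup>\<bottom>\<close>, where \<open>\<Omega>[-wX]\<close> is expanded in \<open>w = z\<^sup>-\<^sup>1\<close>;
  for each argument only finitely many terms are nonzero.
\<close>

definition Bernstein :: "int \<Rightarrow> symf \<Rightarrow> symf" where
  "Bernstein r P =
    Sum_any (\<lambda>i. hsym (r + int i) * perp (fps_nth (Omega (- (fps_X * fps_const (psum 1)))) i) P)"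

definition Bernstein_seq :: "int list \<Rightarrow> symf \<Rightarrow> symf" where
  "Bernstein_seq nu = foldr (\<lambda>r V. Bernstein r \<circ> V) nu id"

datatype shape = Square | Horizontal | Vertical

fun f_shape :: "shape \<Rightarrow> symf" where
  "f_shape Square = schur [1] + schur [1, 1]"
| "f_shape Horizontal = schur [2]"
| "f_shape Vertical = schur [1, 1]"

definition schur_shape :: "shape \<Rightarrow> nat list \<Rightarrow> symf" where
  "schur_shape d lam = Omega_perp (- f_shape d) (schur lam)"

definition Bernstein_shape :: "shape \<Rightarrow> int list \<Rightarrow> symf \<Rightarrow> symf" where
  "Bernstein_shape d nu = Omega_perp (- f_shape d) \<circ> Bernstein_seq nu \<circ> Omega_perp (f_shape d)"

text \<open>
  Symmetric functions in two sets of variables \<open>X\<close> and \<open>Y\<close>: polynomials in the \<open>p\<^sub>k[Y]\<close>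
  whose coefficients are symmetric functions of \<open>X\<close>.
\<close>

type_synonym symf2 = "(nat \<Rightarrow>\<^sub>0 nat) \<Rightarrow>\<^sub>0 symf"

text \<open>\<open>P[tX + (1 - t)Y]\<close>\<close>

definition plethysm_tXY :: "symf \<Rightarrow> symf2" where
  "plethysm_tXY = psubst (\<lambda>c. cst (cst c))
    (\<lambda>k. cst (cst (tvar ^ k) * psum k) + cst (cst (1 - tvar ^ k)) * psum k)"

definition sym_in_Y :: "symf \<Rightarrow> symf2" where
  "sym_in_Y = psubst (\<lambda>c. cst (cst c)) psum"

text \<open>\<open>V\<^sup>Y\<close>: the linear operator \<open>V\<close> acts in \<open>Y\<close>, and \<open>X\<close> is treated as a scalar.\<close>

definition act_in_Y :: "(symf \<Rightarrow> symf) \<Rightarrow> symf2 \<Rightarrow> symf2" where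
  "act_in_Y V Q =
    (\<Sum>m\<in>Poly_Mapping.keys Q. cst (Poly_Mapping.lookup Q m) * sym_in_Y (V (pmono m)))"

definition set_Y_to_X :: "symf2 \<Rightarrow> symf" where
  "set_Y_to_X = psubst (\<lambda>c. c) psum"

definition t_analogue :: "(symf \<Rightarrow> symf) \<Rightarrow> symf \<Rightarrow> symf" where
  "t_analogue V P = set_Y_to_X (act_in_Y V (plethysm_tXY P))"

definition t_Bernstein_shape :: "shape \<Rightarrow> int list \<Rightarrow> symf \<Rightarrow> symf" where
  "t_Bernstein_shape d nu = t_analogue (Bernstein_shape d nu)"

text \<open>The coefficient \<open>d\<^sub>\<lambda>\<^sub>R(t)\<close>.\<close>

definition d_coeff :: "shape \<Rightarrow> nat list \<Rightarrow> nat list list \<Rightarrow> rat poly" where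
  "d_coeff d lam R = Poly_Mapping.lookup
    (coords (schur_shape d) (foldr (\<lambda>Rj. t_Bernstein_shape d (map int Rj)) R 1)) lam"

end

theory Submission
  imports Defs
begin

text \<open>
  The three series \<open>f\<^sub>\<diamondsuit>\<close> differ by single power sums: \<open>f\<^sub>\<box> = f\<^sub>v + p\<^sub>1\<close> and \<open>f\<^sub>h = f\<^sub>v + p\<^sub>2\<close>. The operator
  \<open>T = \<Omega>[p\<^sub>j]\<^sup>\<bottom>\<close> is the ring automorphism that adds constants to the power sums. Conjugation by such a
  translation commutes with the \<open>t\<close>-analogue of an arbitrary linear operator, because
  \<open>t\<^sup>k c + (1 - t\<^sup>k) c = c\<close>. Hence passing from \<open>v\<close> to another shape applies the same automorphism \<open>T\<^sup>-\<^sup>1\<close> to the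
  iterated operators evaluated at \<open>1\<close> and to the basis \<open>s\<^sup>\<diamondsuit>\<^sub>\<lambda>\<close>, and the coefficients do not change.

  That \<open>p\<^sub>k\<^sup>\<bottom>\<close> is \<open>k \<partial>/\<partial>p\<^sub>k\<close> requires that the determinants \<open>s\<^sub>\<lambda>\<close> form an orthonormal basis for the form with
  \<open>\<langle>p\<^sub>\<lambda>, p\<^sub>\<mu>\<rangle> = z\<^sub>\<lambda> \<delta>\<^sub>\<lambda>\<^sub>\<mu>\<close>. Orthonormality follows by expanding \<open>s\<^sub>\<lambda>\<close> along its first row and moving the factors
  \<open>h\<^sub>r\<close> with \<open>r \<ge> \<lambda>\<^sub>1\<close> to the other side, where \<open>h\<^sub>r\<^sup>\<bottom> s\<^sub>\<mu>\<close> is \<open>0\<close> for \<open>r > \<mu>\<^sub>1\<close> and removes the first row for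
  \<open>r = \<mu>\<^sub>1\<close>.
\<close>

subsection \<open>Polynomials in the power sums\<close>

lemma prod_keys_superset:
  fixes a :: "nat \<Rightarrow> 'b::comm_ring_1" and m :: "nat \<Rightarrow>\<^sub>0 nat"
  assumes "finite A" "Poly_Mapping.keys m \<subseteq> A"
  shows "(\<Prod>i\<in>Poly_Mapping.keys m. a (Suc i) ^ Poly_Mapping.lookup m i)
    = (\<Prod>i\<in>A. a (Suc i) ^ Poly_Mapping.lookup m i)"
  by (rule prod.mono_neutral_left) (use assms in \<open>auto simp: in_keys_iff\<close>)

text \<open>The monomial factor of \<open>psubst\<close>, split off because its multiplicativity
  makes \<open>psubst\<close> multiplicative. The argument \<open>Suc i\<close> reflects that
  variable i is p_(i+1).\<close>

definition monom_val :: "(nat \<Rightarrow> 'b::comm_ring_1) \<Rightarrow> (nat \<Rightarrow>\<^sub>0 nat) \<Rightarrow> 'b" where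
  "monom_val a m = (\<Prod>i\<in>Poly_Mapping.keys m. a (Suc i) ^ Poly_Mapping.lookup m i)"

lemma monom_val_0 [simp]: "monom_val a 0 = 1"
  by (simp add: monom_val_def)

lemma monom_val_single [simp]: "monom_val a (Poly_Mapping.single i k) = a (Suc i) ^ k"
  by (simp add: monom_val_def)

lemma monom_val_add: "monom_val a (m + n) = monom_val a m * monom_val a n"
proof -
  let ?A = "Poly_Mapping.keys m \<union> Poly_Mapping.keys n"
  have "monom_val a (m + n) = (\<Prod>i\<in>?A. a (Suc i) ^ Poly_Mapping.lookup (m + n) i)"
    unfolding monom_val_def by (rule prod_keys_superset) (use keys_add[of m n] in auto)
  also have "\<dots> = (\<Prod>i\<in>?A. a (Suc i) ^ Poly_Mapping.lookup m i) * (\<Prod>i\<in>?A. a (Suc i) ^ Poly_Mapping.lookup n i)"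
    by (simp add: lookup_add power_add prod.distrib)
  also have "\<dots> = monom_val a m * monom_val a n"
    unfolding monom_val_def by (subst (1 2) prod_keys_superset[where A = ?A]) auto
  finally show ?thesis .
qed

lemma poly_mapping_sum_single:
  "(\<Sum>m\<in>Poly_Mapping.keys P. Poly_Mapping.single m (Poly_Mapping.lookup P m)) = P"
  by (rule poly_mapping_eqI) (auto simp: lookup_sum lookup_single when_def sum.delta in_keys_iff)

lemma poly_mapping_add_induct [case_names single add]:
  assumes "\<And>m c. Q (Poly_Mapping.single m c)" "\<And>x y. Q x \<Longrightarrow> Q y \<Longrightarrow> Q (x + y)"
  shows "Q (P :: 'a \<Rightarrow>\<^sub>0 'b::comm_monoid_add)"
proof -
  have "Q (\<Sum>m\<in>A. Poly_Mapping.single m (Poly_Mapping.lookup P m))" if "finite A" for A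
    using that
  proof induction
    case empty
    show ?case using assms(1)[of undefined 0] by simp
  next
    case (insert x F)
    then show ?case using assms by simp
  qed
  from this[of "Poly_Mapping.keys P"] show ?thesis by (simp add: poly_mapping_sum_single)
qed

lemma comm_ring_hom_cst: "comm_ring_hom (cst :: 'c::comm_ring_1 \<Rightarrow> _)"
  by unfold_locales (auto simp: cst_def single_add mult_single)

interpretation cst: comm_ring_hom "cst :: 'c::comm_ring_1 \<Rightarrow> _"
  by (rule comm_ring_hom_cst)

lemma cst_mult_single: "cst c * Poly_Mapping.single m d = Poly_Mapping.single m (c * d)"
  by (simp add: cst_def mult_single)

lemma cst_mult_pmono: "cst (c :: 'c::comm_ring_1) * pmono m = Poly_Mapping.single m c"
  by (simp add: pmono_def cst_mult_single)

lemma lookup_cst_mult: 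
  "Poly_Mapping.lookup (cst (c::'c::comm_ring_1) * P) m = c * Poly_Mapping.lookup P m"
  by (induction P rule: poly_mapping_add_induct)
     (auto simp: cst_mult_single lookup_single when_def distrib_left lookup_add)

lemma pmono_add: "pmono (m + n) = pmono m * (pmono n :: _ \<Rightarrow>\<^sub>0 'c::comm_ring_1)"
  by (simp add: pmono_def mult_single)

lemma pmono_0: "pmono 0 = (1 :: _ \<Rightarrow>\<^sub>0 'c::comm_ring_1)"
  by (simp add: pmono_def)

lemma psubst_monom_val:
  "psubst \<phi> a P = (\<Sum>m\<in>Poly_Mapping.keys P. \<phi> (Poly_Mapping.lookup P m) * monom_val a m)"
  by (simp add: psubst_def monom_val_def)

lemma psubst_superset:
  assumes "\<phi> 0 = 0" "finite A" "Poly_Mapping.keys P \<subseteq> A"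
  shows "psubst \<phi> a P = (\<Sum>m\<in>A. \<phi> (Poly_Mapping.lookup P m) * monom_val a m)"
  unfolding psubst_monom_val
  by (rule sum.mono_neutral_left) (use assms in \<open>auto simp: in_keys_iff\<close>)

text \<open>Existence half of the universal property of a polynomial ring. Additivity comes from
  summing over a common set of monomials; it reduces multiplicativity to single terms, where it is
  \<open>monom_val_add\<close>.\<close>

lemma comm_ring_hom_psubst:
  assumes "comm_ring_hom (\<phi> :: 'c::comm_ring_1 \<Rightarrow> 'b::comm_ring_1)"
  shows "comm_ring_hom (psubst \<phi> a)"
proof -
  interpret \<phi>: comm_ring_hom \<phi> by fact
  have add: "psubst \<phi> a (P + Q) = psubst \<phi> a P + psubst \<phi> a Q" for P Q
  proof -
    let ?A = "Poly_Mapping.keys P \<union> Poly_Mapping.keys Q"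
    have "psubst \<phi> a (P + Q) = (\<Sum>m\<in>?A. \<phi> (Poly_Mapping.lookup (P + Q) m) * monom_val a m)"
      by (rule psubst_superset) (use keys_add[of P Q] in auto)
    also have "\<dots> = (\<Sum>m\<in>?A. \<phi> (Poly_Mapping.lookup P m) * monom_val a m)
        + (\<Sum>m\<in>?A. \<phi> (Poly_Mapping.lookup Q m) * monom_val a m)"
      by (simp add: lookup_add \<phi>.hom_add distrib_right sum.distrib)
    also have "\<dots> = psubst \<phi> a P + psubst \<phi> a Q"
      by (subst (1 2) psubst_superset[where A = ?A]) auto
    finally show ?thesis .
  qed
  have single: "psubst \<phi> a (Poly_Mapping.single m c) = \<phi> c * monom_val a m" for m c
    by (simp add: psubst_monom_val)
  have mult1: "psubst \<phi> a (Poly_Mapping.single m c * Q) = psubst \<phi> a (Poly_Mapping.single m c) * psubst \<phi> a Q" for m c Q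
    by (induction Q rule: poly_mapping_add_induct)
       (simp_all add: mult_single single monom_val_add \<phi>.hom_mult add distrib_left algebra_simps)
  have mult: "psubst \<phi> a (P * Q) = psubst \<phi> a P * psubst \<phi> a Q" for P Q
    by (induction P rule: poly_mapping_add_induct) (simp_all add: mult1 add distrib_right)
  have "psubst \<phi> a 1 = 1"
    using single[of 0 1] by simp
  moreover have "psubst \<phi> a 0 = 0" by (simp add: psubst_def)
  ultimately show ?thesis
    by unfold_locales (auto simp: add mult)
qed

lemma psubst_single:
  assumes "\<phi> 0 = 0" shows "psubst \<phi> a (Poly_Mapping.single m c) = \<phi> c * monom_val a m"
  using assms by (simp add: psubst_monom_val)

lemma psubst_cst: "\<phi> 0 = 0 \<Longrightarrow> psubst \<phi> a (cst c) = \<phi> c"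
  by (simp add: cst_def psubst_single)

lemma psubst_pmono:
  "\<phi> 0 = 0 \<Longrightarrow> \<phi> 1 = 1 \<Longrightarrow> psubst \<phi> a (pmono m :: _ \<Rightarrow>\<^sub>0 'c::zero_neq_one) = monom_val a m"
  by (simp add: pmono_def psubst_single)

lemma psubst_psum:
  "\<phi> 0 = 0 \<Longrightarrow> \<phi> 1 = 1 \<Longrightarrow> k > 0 \<Longrightarrow> psubst \<phi> a (psum k :: _ \<Rightarrow>\<^sub>0 'c::zero_neq_one) = a k"
  by (simp add: psum_def psubst_pmono)

lemma pmono_power: "pmono (Poly_Mapping.single i n) = (pmono (Poly_Mapping.single i 1) :: _ \<Rightarrow>\<^sub>0 'c::comm_ring_1) ^ n"
proof (induction n)
  case (Suc n)
  have "Poly_Mapping.single i (Suc n) = Poly_Mapping.single i 1 + Poly_Mapping.single i n"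
    by (simp flip: single_add)
  with Suc show ?case by (simp add: pmono_add)
qed (simp add: pmono_0)

lemma pmono_sum:
  "finite A \<Longrightarrow> pmono (\<Sum>i\<in>A. f i) = (\<Prod>i\<in>A. pmono (f i) :: _ \<Rightarrow>\<^sub>0 'c::comm_ring_1)"
  by (induction A rule: finite_induct) (simp_all add: pmono_0 pmono_add)

lemma monom_val_psum: "monom_val psum m = (pmono m :: _ \<Rightarrow>\<^sub>0 'c::comm_ring_1)"
proof -
  have "(pmono m :: _ \<Rightarrow>\<^sub>0 'c) = pmono (\<Sum>i\<in>Poly_Mapping.keys m. Poly_Mapping.single i (Poly_Mapping.lookup m i))"
    by (simp add: poly_mapping_sum_single)
  also have "\<dots> = (\<Prod>i\<in>Poly_Mapping.keys m. psum (Suc i) ^ Poly_Mapping.lookup m i)"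
    by (simp add: pmono_sum pmono_power[of _ "Poly_Mapping.lookup m _"] psum_def)
  finally show ?thesis by (simp add: monom_val_def)
qed

text \<open>Constants and power sums generate the ring: by \<open>monom_val_psum\<close>, a single
  term is its coefficient times a product of powers of power sums.\<close>

lemma power_sum_induct [case_names cst psum add mult]:
  fixes P :: "(nat \<Rightarrow>\<^sub>0 nat) \<Rightarrow>\<^sub>0 'c::comm_ring_1"
  assumes "\<And>c. Q (cst c)" "\<And>k. k > 0 \<Longrightarrow> Q (psum k)"
    and "\<And>x y. Q x \<Longrightarrow> Q y \<Longrightarrow> Q (x + y)" "\<And>x y. Q x \<Longrightarrow> Q y \<Longrightarrow> Q (x * y)"
  shows "Q P"
proof (induction P rule: poly_mapping_add_induct)
  case (single m c)
  have one: "Q 1" using assms(1)[of 1] by simp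
  have pow: "Q (psum (Suc i) ^ n)" for i n
    by (induction n) (simp_all add: one assms)
  have "Q (\<Prod>i\<in>A. psum (Suc i) ^ f i)" if "finite A" for A f
    using that by induction (simp_all add: one pow assms)
  from this[of "Poly_Mapping.keys m" "Poly_Mapping.lookup m"] have "Q (pmono m)"
    by (simp add: monom_val_def flip: monom_val_psum)
  with assms(1)[of c] assms(4) show ?case
    unfolding cst_mult_pmono[symmetric] by blast
qed (rule assms(3))

text \<open>Uniqueness half of the universal property. Identities between substitutions are checked
  on generators through it.\<close>

lemma power_sum_hom_eqI:
  fixes f g :: "((nat \<Rightarrow>\<^sub>0 nat) \<Rightarrow>\<^sub>0 'c::comm_ring_1) \<Rightarrow> 'b::comm_ring_1"
  assumes "comm_ring_hom f" "comm_ring_hom g"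
    and "\<And>c. f (cst c) = g (cst c)" "\<And>k. k > 0 \<Longrightarrow> f (psum k) = g (psum k)"
  shows "f P = g P"
proof -
  interpret f: comm_ring_hom f by fact
  interpret g: comm_ring_hom g by fact
  show ?thesis
    by (induction P rule: power_sum_induct) (simp_all add: assms f.hom_add f.hom_mult g.hom_add g.hom_mult)
qed

subsection \<open>The power sum form and its adjoints\<close>

text \<open>This is z_lambda for the partition lambda with \<open>lookup m i\<close> parts equal to
  i+1.\<close>

definition zee :: "(nat \<Rightarrow>\<^sub>0 nat) \<Rightarrow> rat" where
  "zee m = (\<Prod>i\<in>Poly_Mapping.keys m. of_nat (Suc i) ^ Poly_Mapping.lookup m i * fact (Poly_Mapping.lookup m i))"

lemma zee_pos: "zee m > 0"
  unfolding zee_def by (intro prod_pos) simp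

lemma zee_nonzero [simp]: "zee m \<noteq> 0"
  using zee_pos[of m] by simp

lemma zee_0 [simp]: "zee 0 = 1"
  by (simp add: zee_def)

lemma zee_superset:
  assumes "finite A" "Poly_Mapping.keys m \<subseteq> A"
  shows "zee m = (\<Prod>i\<in>A. of_nat (Suc i) ^ Poly_Mapping.lookup m i * fact (Poly_Mapping.lookup m i))"
  unfolding zee_def by (rule prod.mono_neutral_left) (use assms in \<open>auto simp: in_keys_iff\<close>)

text \<open>One more factor p_(i+1) contributes one more part size and turns r! into (r+1)!. This
  quotient is the source of the factor k in the adjoint k d/dp_k of p_k.\<close>

lemma zee_add_single:
  "zee (Poly_Mapping.single i 1 + m) = of_nat (Suc i * Suc (Poly_Mapping.lookup m i)) * zee m"
proof -
  let ?A = "insert i (Poly_Mapping.keys m)"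
  have "zee (Poly_Mapping.single i 1 + m) = (\<Prod>j\<in>?A. of_nat (Suc j) ^ Poly_Mapping.lookup (Poly_Mapping.single i 1 + m) j
     * fact (Poly_Mapping.lookup (Poly_Mapping.single i 1 + m) j))"
    by (rule zee_superset) (use keys_add[of "Poly_Mapping.single i 1" m] in auto)
  also have "\<dots> = (\<Prod>j\<in>?A. (of_nat (Suc j) ^ Poly_Mapping.lookup m j * fact (Poly_Mapping.lookup m j)) *
       (if j = i then of_nat (Suc i * Suc (Poly_Mapping.lookup m i)) else 1))"
    by (rule prod.cong) (auto simp: lookup_add lookup_single when_def algebra_simps)
  also have "\<dots> = zee m * of_nat (Suc i * Suc (Poly_Mapping.lookup m i))"
    by (subst zee_superset[of ?A m]) (auto simp: prod.distrib prod.delta)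
  finally show ?thesis by simp
qed

text \<open>The Hall form written in the power sum basis, where adjoints are explicit. Its agreement
  with \<open>scalar_product\<close> is \<open>scalar_product_eq_pform\<close>.\<close>

definition pform :: "symf \<Rightarrow> symf \<Rightarrow> rat poly" where
  "pform P Q = (\<Sum>m\<in>Poly_Mapping.keys P. smult (zee m) (Poly_Mapping.lookup P m * Poly_Mapping.lookup Q m))"

lemma pform_superset:
  assumes "finite A" "Poly_Mapping.keys P \<subseteq> A"
  shows "pform P Q = (\<Sum>m\<in>A. smult (zee m) (Poly_Mapping.lookup P m * Poly_Mapping.lookup Q m))"
  unfolding pform_def by (rule sum.mono_neutral_left) (use assms in \<open>auto simp: in_keys_iff\<close>)

lemma pform_commute: "pform P Q = pform Q P"
  by (subst (1 2) pform_superset[where A = "Poly_Mapping.keys P \<union> Poly_Mapping.keys Q"])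
     (auto simp: mult.commute)

lemma pform_add_right: "pform P (Q + R) = pform P Q + pform P R"
  by (simp add: pform_def lookup_add distrib_left sum.distrib smult_add_right)

lemma pform_add_left: "pform (P + Q) R = pform P R + pform Q R"
  using pform_add_right pform_commute by metis

lemma pform_cst_right: "pform P (cst c * Q) = c * pform P Q"
  by (simp add: pform_def lookup_cst_mult sum_distrib_left mult.left_commute)

lemma pform_cst_left: "pform (cst c * P) Q = c * pform P Q"
  using pform_cst_right pform_commute by metis

lemma pform_0_left [simp]: "pform 0 Q = 0"
  by (simp add: pform_def)

lemma pform_0_right [simp]: "pform P 0 = 0"
  by (simp add: pform_def)

lemma pform_sum_left: "pform (\<Sum>x\<in>A. f x) Q = (\<Sum>x\<in>A. pform (f x) Q)"
  by (induction A rule: infinite_finite_induct) (simp_all add: pform_add_left)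

lemma pform_sum_right: "pform P (\<Sum>x\<in>A. f x) = (\<Sum>x\<in>A. pform P (f x))"
  by (induction A rule: infinite_finite_induct) (simp_all add: pform_add_right)

lemma pform_single: "pform (Poly_Mapping.single m c) Q = smult (zee m) (c * Poly_Mapping.lookup Q m)"
  by (simp add: pform_def)

text \<open>Nondegeneracy: pairing with a monomial reads off one coefficient up to a nonzero
  rational factor.\<close>

lemma pform_eqI:
  assumes "\<And>S. pform S P = pform S Q"
  shows "P = Q"
proof (rule poly_mapping_eqI)
  fix m
  from assms[of "Poly_Mapping.single m 1"]
  have "smult (zee m) (Poly_Mapping.lookup P m) = smult (zee m) (Poly_Mapping.lookup Q m)"
    by (simp add: pform_single)
  thus "Poly_Mapping.lookup P m = Poly_Mapping.lookup Q m"
    by (metis smult_smult zee_nonzero smult_1_left left_inverse)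
qed

text \<open>The form is diagonal on monomials, so the adjoint of multiplication by a monomial can be
  solved for coefficientwise; the quotient compares the two norms. The support is finite because
  adding m is injective.\<close>

definition pmono_adj :: "(nat \<Rightarrow>\<^sub>0 nat) \<Rightarrow> symf \<Rightarrow> symf" where
  "pmono_adj m Q = Abs_poly_mapping (\<lambda>k. smult (zee (m + k) / zee k) (Poly_Mapping.lookup Q (m + k)))"

lemma lookup_pmono_adj:
  "Poly_Mapping.lookup (pmono_adj m Q) k = smult (zee (m + k) / zee k) (Poly_Mapping.lookup Q (m + k))"
proof -
  have "finite ((+) m -` Poly_Mapping.keys Q)"
    by (rule finite_vimageI) auto
  hence "finite {k. smult (zee (m + k) / zee k) (Poly_Mapping.lookup Q (m + k)) \<noteq> 0}"
    by (rule rev_finite_subset) (auto simp: in_keys_iff)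
  thus ?thesis by (simp add: pmono_adj_def)
qed

definition padj :: "symf \<Rightarrow> symf \<Rightarrow> symf" where
  "padj P Q = (\<Sum>m\<in>Poly_Mapping.keys P. cst (Poly_Mapping.lookup P m) * pmono_adj m Q)"

lemma pform_pmono_adj: "pform S (pmono_adj m Q) = pform (pmono m * S) Q"
  by (induction S rule: poly_mapping_add_induct)
     (simp_all add: pform_add_left distrib_left pform_single lookup_pmono_adj pmono_def mult_single)

lemma pform_padj: "pform S (padj P Q) = pform (P * S) Q"
proof -
  have "pform S (padj P Q) = pform ((\<Sum>m\<in>Poly_Mapping.keys P. cst (Poly_Mapping.lookup P m) * pmono m) * S) Q"
    unfolding padj_def
    by (simp add: pform_sum_right pform_cst_right pform_pmono_adj sum_distrib_right pform_sum_left mult.assoc pform_cst_left)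
  thus ?thesis by (simp add: cst_mult_pmono poly_mapping_sum_single)
qed

text \<open>Nondegeneracy makes adjoints unique, so the algebraic laws of \<open>padj\<close> follow
  by checking the defining equation.\<close>

lemma padj_unique: "(\<And>S. pform S Q' = pform (P * S) Q) \<Longrightarrow> Q' = padj P Q"
  by (rule pform_eqI) (simp add: pform_padj)

lemma padj_add_right: "padj P (Q + R) = padj P Q + padj P R"
  by (rule padj_unique[symmetric]) (simp add: pform_padj pform_add_right)

lemma padj_add_left: "padj (P + Q) R = padj P R + padj Q R"
  by (rule padj_unique[symmetric]) (simp add: pform_padj pform_add_right distrib_right pform_add_left)

lemma padj_cst_right: "padj P (cst c * Q) = cst c * padj P Q"
  by (rule padj_unique[symmetric]) (simp add: pform_padj pform_cst_right)

lemma padj_cst_left: "padj (cst c * P) Q = cst c * padj P Q"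
  by (rule padj_unique[symmetric]) (simp add: pform_padj pform_cst_right pform_cst_left mult.assoc)

lemma padj_0_left [simp]: "padj 0 Q = 0"
  by (simp add: padj_def)

lemma padj_0_right [simp]: "padj P 0 = 0"
  using padj_cst_right[of P 0 0] by simp

lemma padj_1_left [simp]: "padj 1 Q = Q"
  by (rule padj_unique[symmetric]) simp

lemma padj_cst: "padj (cst c) Q = cst c * Q"
  using padj_cst_left[of c 1 Q] by simp

lemma padj_mult: "padj (P * Q) R = padj P (padj Q R)"
  by (rule padj_unique[symmetric]) (simp add: pform_padj algebra_simps)

lemma padj_sum_left: "padj (\<Sum>x\<in>A. f x) Q = (\<Sum>x\<in>A. padj (f x) Q)"
  by (induction A rule: infinite_finite_induct) (simp_all add: padj_add_left)

lemma padj_sum_right: "padj P (\<Sum>x\<in>A. f x) = (\<Sum>x\<in>A. padj P (f x))"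
  by (induction A rule: infinite_finite_induct) (simp_all add: padj_add_right)

text \<open>The quotient of norms in \<open>zee_add_single\<close> is k times the old exponent, so
  the adjoint of p_k acts as k d/dp_k.\<close>

lemma padj_psum_single:
  assumes "k > 0"
  shows "padj (psum k) (Poly_Mapping.single m c) =
    Poly_Mapping.single (m - Poly_Mapping.single (k - 1) 1) (smult (of_nat (k * Poly_Mapping.lookup m (k - 1))) c)"
proof (rule poly_mapping_eqI)
  fix n
  obtain i where k: "k = Suc i" using assms gr0_implies_Suc by blast
  \<comment> \<open>Subtraction of exponents is truncated. Positivity of the exponent excludes the
    case in which nothing is removed; there the coefficient on the right-hand side is 0.\<close>
  have *: "m = Poly_Mapping.single i 1 + n \<longleftrightarrow> Poly_Mapping.lookup m i > 0 \<and> m - Poly_Mapping.single i 1 = n"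
  proof
    assume "Poly_Mapping.lookup m i > 0 \<and> m - Poly_Mapping.single i 1 = n"
    moreover from this have "m = Poly_Mapping.single i 1 + (m - Poly_Mapping.single i 1)"
      by (intro poly_mapping_eqI) (auto simp: lookup_add lookup_minus lookup_single when_def)
    ultimately show "m = Poly_Mapping.single i 1 + n" by simp
  qed (auto simp: lookup_add)
  have "Poly_Mapping.lookup (padj (psum k) (Poly_Mapping.single m c)) n =
     smult (of_nat (Suc i * Suc (Poly_Mapping.lookup n i))) (c when m = Poly_Mapping.single i 1 + n)"
    by (simp add: padj_def psum_def pmono_def k lookup_pmono_adj lookup_single zee_add_single[unfolded One_nat_def] del: of_nat_mult of_nat_Suc)
  also have "\<dots> = Poly_Mapping.lookup (Poly_Mapping.single (m - Poly_Mapping.single i 1) (smult (of_nat (Suc i * Poly_Mapping.lookup m i)) c)) n"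
  proof (cases "m = Poly_Mapping.single i 1 + n")
    case True
    then show ?thesis using * by (auto simp: lookup_single lookup_add)
  next
    case False
    with * show ?thesis by (auto simp: lookup_single when_def)
  qed
  finally show "Poly_Mapping.lookup (padj (psum k) (Poly_Mapping.single m c)) n =
    Poly_Mapping.lookup (Poly_Mapping.single (m - Poly_Mapping.single (k - 1) 1) (smult (of_nat (k * Poly_Mapping.lookup m (k - 1))) c)) n"
    by (simp add: k)
qed

lemma padj_psum_cst: "k > 0 \<Longrightarrow> padj (psum k) (cst c) = 0"
  by (simp add: cst_def padj_psum_single)

lemma padj_psum_psum_mult:
  assumes "k > 0" "j > 0"
  shows "padj (psum k) (psum j * Q) = psum j * padj (psum k) Q + (if j = k then of_nat k * Q else 0)"
proof (induction Q rule: poly_mapping_add_induct)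
  case (single m c)
  let ?ej = "Poly_Mapping.single (j - 1) (1::nat)" and ?ek = "Poly_Mapping.single (k - 1) (1::nat)"
  have nat_mult: "of_nat k * Poly_Mapping.single m c = Poly_Mapping.single m (smult (of_nat k) c)" 
    using cst_mult_single[of "of_nat k" m c] unfolding cst.hom_of_nat by (simp add: of_nat_poly)
  show ?case
  proof (cases "j = k")
    case True
    show ?thesis
    proof (cases "Poly_Mapping.lookup m (k - 1) = 0")
      case True
      then show ?thesis using \<open>j = k\<close> assms
        by (simp add: psum_def pmono_def mult_single padj_psum_single[unfolded psum_def pmono_def One_nat_def] lookup_add nat_mult)
    next
      case False
      have "?ek + (m - ?ek) = m"
        using False by (intro poly_mapping_eqI) (auto simp: lookup_add lookup_minus lookup_single when_def)
      thus ?thesis using \<open>j = k\<close> assms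
        by (simp add: psum_def pmono_def mult_single padj_psum_single[unfolded psum_def pmono_def One_nat_def] lookup_add nat_mult
          algebra_simps flip: single_add smult_add_left)
    qed
  next
    case False
    have "?ej + m - ?ek = ?ej + (m - ?ek)"
      using False assms by (intro poly_mapping_eqI) (auto simp: lookup_add lookup_minus lookup_single when_def)
    moreover have "j - Suc 0 \<noteq> k - Suc 0"
      using False assms by simp
    ultimately show ?thesis using False assms
        by (simp add: psum_def pmono_def mult_single padj_psum_single[unfolded psum_def pmono_def One_nat_def] lookup_add lookup_single when_def)
  qed
qed (simp_all add: distrib_left padj_add_right)

text \<open>The Leibniz rule passes from generators to sums and products of P. Q stays arbitrary
  because the product case applies the hypothesis for x to \<open>y * Q\<close>.\<close>

lemma padj_psum_mult:
  assumes "k > 0"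
  shows "padj (psum k) (P * Q) = P * padj (psum k) Q + padj (psum k) P * Q"
proof (induction P arbitrary: Q rule: power_sum_induct)
  case (psum j)
  have "padj (psum k) (psum j * 1) = (if j = k then of_nat k else 0)"
    using padj_psum_psum_mult[OF assms psum, of 1] padj_psum_cst[OF assms, of 1] by simp
  then show ?case
    by (simp add: padj_psum_psum_mult[OF assms psum])
next
  case (mult x y)
  have "padj (psum k) (x * y * Q) = x * padj (psum k) (y * Q) + padj (psum k) x * (y * Q)"
    by (simp only: mult.assoc mult.IH)
  also have "\<dots> = x * (y * padj (psum k) Q + padj (psum k) y * Q) + padj (psum k) x * (y * Q)"
    by (simp only: mult.IH)
  also have "\<dots> = x * y * padj (psum k) Q + (x * padj (psum k) y + padj (psum k) x * y) * Q"
    by (simp add: algebra_simps)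
  finally show ?case by (simp only: mult.IH)
qed (simp_all add: assms padj_cst_right padj_psum_cst padj_add_right distrib_right)

subsection \<open>Adding a letter to the alphabet\<close>

lemma comm_ring_hom_id: "comm_ring_hom (\<lambda>x :: 'c::comm_ring_1. x)"
  by unfold_locales auto

text \<open>For \<open>c = 1\<close> this is \<open>P \<mapsto> P[X + z]\<close>.\<close>

definition shift :: "(nat \<Rightarrow> rat) \<Rightarrow> symf \<Rightarrow> symf poly" where
  "shift c = psubst (\<lambda>x. [:cst x:]) (\<lambda>k. [:psum k:] + Polynomial.monom (cst [:c k:]) k)"

lemma comm_ring_hom_shift: "comm_ring_hom (shift c)"
  unfolding shift_def
  by (intro comm_ring_hom_psubst) (unfold_locales, simp_all add: cst.hom_add cst.hom_mult flip: one_pCons)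

interpretation shift: comm_ring_hom "shift c"
  by (rule comm_ring_hom_shift)

lemma shift_cst [simp]: "shift c (cst x) = [:cst x:]"
  by (simp add: shift_def psubst_cst)

lemma shift_psum: "k > 0 \<Longrightarrow> shift c (psum k) = [:psum k:] + Polynomial.monom (cst [:c k:]) k"
  by (simp add: shift_def psubst_psum flip: one_pCons)

text \<open>Chain rule: z d/dz of p_k + c_k z^k is k c_k z^k, and k d/dp_k is the adjoint of p_k.
  Both sides obey the Leibniz rule, so generators suffice. Only finitely many p_i occur in Q;
  stating the identity for all large M lets two arguments share a bound.\<close>

lemma pderiv_shift:
  "\<exists>N. \<forall>M\<ge>N. [:0, 1:] * pderiv (shift c Q) =
     (\<Sum>i=1..M. Polynomial.monom (cst [:c i:]) i * shift c (padj (psum i) Q))"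
proof (induction Q rule: power_sum_induct)
  case (cst x)
  show ?case by (auto simp: padj_psum_cst pderiv_pCons)
next
  case (psum k)
  have "[:0, 1:] * pderiv (shift c (psum k)) =
     (\<Sum>i=1..M. Polynomial.monom (cst [:c i:]) i * shift c (padj (psum i) (psum k)))" if "M \<ge> k" for M
  proof -
    have *: "padj (psum i) (psum k) = (if k = i then of_nat k else 0)" if "i > 0" for i
      using padj_psum_psum_mult[OF that psum, of 1] padj_psum_cst[OF that, of 1] by simp
    have "(\<Sum>i=1..M. Polynomial.monom (cst [:c i:]) i * shift c (padj (psum i) (psum k))) =
        (\<Sum>i=1..M. if i = k then Polynomial.monom (cst [:c k:]) k * of_nat k else 0)"
      by (rule sum.cong) (auto simp: * shift.hom_of_nat)
    also have "\<dots> = Polynomial.monom (cst [:c k:]) k * of_nat k"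
      using that psum by (simp add: sum.delta)
    also have "\<dots> = [:0, 1:] * pderiv (shift c (psum k))"
      using psum by (simp add: shift_psum pderiv_add pderiv_pCons pderiv_monom of_nat_poly mult.commute smult_monom
         flip: monom_Suc)
    finally show ?thesis ..
  qed
  then show ?case by blast
next
  case (add x y)
  then obtain N N' where *: "\<forall>M\<ge>N. [:0, 1:] * pderiv (shift c x) =
      (\<Sum>i=1..M. Polynomial.monom (cst [:c i:]) i * shift c (padj (psum i) x))"
    "\<forall>M\<ge>N'. [:0, 1:] * pderiv (shift c y) =
      (\<Sum>i=1..M. Polynomial.monom (cst [:c i:]) i * shift c (padj (psum i) y))" by blast
  show ?case
  proof (intro exI[of _ "max N N'"] allI impI)
    fix M assume "max N N' \<le> M"
    with * have "[:0, 1:] * pderiv (shift c x) =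
        (\<Sum>i=1..M. Polynomial.monom (cst [:c i:]) i * shift c (padj (psum i) x))"
      "[:0, 1:] * pderiv (shift c y) =
        (\<Sum>i=1..M. Polynomial.monom (cst [:c i:]) i * shift c (padj (psum i) y))"
      by auto
    thus "[:0, 1:] * pderiv (shift c (x + y)) =
      (\<Sum>i=1..M. Polynomial.monom (cst [:c i:]) i * shift c (padj (psum i) (x + y)))"
      by (simp only: shift.hom_add padj_add_right pderiv_add distrib_left sum.distrib)
  qed
next
  case (mult x y)
  then obtain N N' where *: "\<forall>M\<ge>N. [:0, 1:] * pderiv (shift c x) =
      (\<Sum>i=1..M. Polynomial.monom (cst [:c i:]) i * shift c (padj (psum i) x))"
    "\<forall>M\<ge>N'. [:0, 1:] * pderiv (shift c y) =
      (\<Sum>i=1..M. Polynomial.monom (cst [:c i:]) i * shift c (padj (psum i) y))" by blast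
  show ?case
  proof (intro exI[of _ "max N N'"] allI impI)
    fix M assume M: "max N N' \<le> M"
    let ?m = "\<lambda>i. Polynomial.monom (cst [:c i:]) i"
    have "[:0, 1:] * pderiv (shift c (x * y)) =
      shift c x * ([:0, 1:] * pderiv (shift c y)) + shift c y * ([:0, 1:] * pderiv (shift c x))"
      by (simp only: shift.hom_mult pderiv_mult distrib_left mult.left_commute)
    also have "[:0, 1:] * pderiv (shift c y) = (\<Sum>i=1..M. ?m i * shift c (padj (psum i) y))"
      using * M by auto
    also have "[:0, 1:] * pderiv (shift c x) = (\<Sum>i=1..M. ?m i * shift c (padj (psum i) x))"
      using * M by auto
    also have "shift c x * (\<Sum>i=1..M. ?m i * shift c (padj (psum i) y))
        + shift c y * (\<Sum>i=1..M. ?m i * shift c (padj (psum i) x))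
      = (\<Sum>i=1..M. ?m i * shift c (padj (psum i) (x * y)))"
      unfolding sum_distrib_left sum.distrib[symmetric]
      by (rule sum.cong) (auto simp: padj_psum_mult shift.hom_add shift.hom_mult algebra_simps)
    finally show "[:0, 1:] * pderiv (shift c (x * y)) = (\<Sum>i=1..M. ?m i * shift c (padj (psum i) (x * y)))" .
  qed
qed

lemma coeff_shift_recursion:
  "of_nat n * coeff (shift c Q) n = (\<Sum>i=1..n. cst [:c i:] * coeff (shift c (padj (psum i) Q)) (n - i))"
proof -
  obtain N where N: "\<And>M. M \<ge> N \<Longrightarrow> [:0, 1:] * pderiv (shift c Q) =
      (\<Sum>i=1..M. Polynomial.monom (cst [:c i:]) i * shift c (padj (psum i) Q))"
    using pderiv_shift[of c Q] by blast
  have "of_nat n * coeff (shift c Q) n = coeff ([:0, 1:] * pderiv (shift c Q)) n"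
    by (cases n) (simp_all add: coeff_pderiv)
  \<comment> \<open>The bound is raised to at least n and then cut back to n, since z^i with i > n
    does not reach the coefficient of z^n.\<close>
  also have "\<dots> = (\<Sum>i=1..max N n. coeff (Polynomial.monom (cst [:c i:]) i * shift c (padj (psum i) Q)) n)"
    by (subst N[of "max N n"]) (auto simp: coeff_sum)
  also have "\<dots> = (\<Sum>i=1..n. coeff (Polynomial.monom (cst [:c i:]) i * shift c (padj (psum i) Q)) n)"
    by (rule sum.mono_neutral_right) (auto simp: coeff_monom_mult)
  also have "\<dots> = (\<Sum>i=1..n. cst [:c i:] * coeff (shift c (padj (psum i) Q)) (n - i))"
    by (rule sum.cong) (auto simp: coeff_monom_mult)
  finally show ?thesis .
qed

lemma coeff_shift_0: "coeff (shift c Q) 0 = Q"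
proof (rule power_sum_hom_eqI[where f = "\<lambda>P. coeff (shift c P) 0" and g = "\<lambda>x. x"])
  show "comm_ring_hom (\<lambda>P. coeff (shift c P) 0)"
    by unfold_locales (auto simp: shift.hom_add shift.hom_mult coeff_mult_0)
qed (auto simp: shift_psum comm_ring_hom_id)

text \<open>The recursion says that H has the generating series exp(sum_i c_i p_i z^i / i). Passing
  to adjoints turns it into \<open>coeff_shift_recursion\<close>, and n cancels in characteristic
  0.\<close>

lemma padj_eq_coeff_shift:
  assumes "H 0 = 1"
    and H: "\<And>n. n > 0 \<Longrightarrow> of_nat n * H n = (\<Sum>i=1..n. cst [:c i:] * psum i * H (n - i))"
  shows "padj (H n) Q = coeff (shift c Q) n"
proof (induction n arbitrary: Q rule: less_induct)
  case (less n)
  show ?case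
  proof (cases "n = 0")
    case True
    then show ?thesis by (simp add: assms coeff_shift_0)
  next
    case False
    have "of_nat n * padj (H n) Q = padj (of_nat n * H n) Q"
      using padj_cst_left[of "of_nat n" "H n" Q] by (simp only: cst.hom_of_nat)
    also have "\<dots> = (\<Sum>i=1..n. padj (cst [:c i:] * (H (n - i) * psum i)) Q)"
      using False by (simp only: H gr0I padj_sum_left mult.assoc mult.commute[of "psum _"])
    also have "\<dots> = (\<Sum>i=1..n. cst [:c i:] * coeff (shift c (padj (psum i) Q)) (n - i))"
      by (rule sum.cong) (auto simp: padj_cst padj_mult less.IH)
    also have "\<dots> = of_nat n * coeff (shift c Q) n"
      by (simp only: coeff_shift_recursion)
    finally show ?thesis using False by simp
  qed
qed

section \<open>Translations of the power sums by constants\<close>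

definition translate :: "(nat \<Rightarrow> rat) \<Rightarrow> symf \<Rightarrow> symf" where
  "translate c = psubst cst (\<lambda>k. psum k + cst [:c k:])"

interpretation translate: comm_ring_hom "translate c"
  unfolding translate_def by (intro comm_ring_hom_psubst comm_ring_hom_cst)

lemma translate_cst [simp]: "translate c (cst x) = cst x"
  by (simp add: translate_def psubst_cst)

lemma translate_psum: "k > 0 \<Longrightarrow> translate c (psum k) = psum k + cst [:c k:]"
  by (simp add: translate_def psubst_psum)

lemma poly_shift_1: "poly (shift c Q) 1 = translate c Q"
proof (rule power_sum_hom_eqI[where f = "\<lambda>P. poly (shift c P) 1"])
  show "comm_ring_hom (\<lambda>P. poly (shift c P) 1)"
    by unfold_locales (auto simp: shift.hom_add shift.hom_mult)
qed (auto simp: shift_psum translate_psum poly_monom translate.comm_ring_hom_axioms)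

lemma translate_translate:
  "translate c (translate d Q) = translate (\<lambda>k. c k + d k) Q"
proof (rule power_sum_hom_eqI[where f = "\<lambda>P. translate c (translate d P)"])
  show "comm_ring_hom (\<lambda>P. translate c (translate d P))"
    by unfold_locales (auto simp: translate.hom_add translate.hom_mult)
qed (auto simp: translate_psum translate.hom_add translate.comm_ring_hom_axioms add.assoc add.commute simp flip: cst.hom_add)

lemma translate_zero: "translate (\<lambda>k. 0) Q = Q"
  by (rule power_sum_hom_eqI[where g = "\<lambda>x. x"])
     (auto simp: translate_psum translate.comm_ring_hom_axioms comm_ring_hom_id)

text \<open>Summing the coefficients of the polynomial \<open>shift c Q\<close> amounts to setting z
  = 1.\<close>

lemma Sum_any_padj_eq_translate:
  assumes "H 0 = 1"
    and "\<And>n. n > 0 \<Longrightarrow> of_nat n * H n = (\<Sum>i=1..n. cst [:c i:] * psum i * H (n - i))"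
  shows "Sum_any (\<lambda>n. padj (H n) Q) = translate c Q"
proof -
  have "Sum_any (\<lambda>n. padj (H n) Q) = Sum_any (coeff (shift c Q))"
    by (simp add: padj_eq_coeff_shift[OF assms])
  also have "\<dots> = (\<Sum>n\<le>degree (shift c Q). coeff (shift c Q) n)"
    by (rule Sum_any.expand_superset) (auto intro: le_degree)
  also have "\<dots> = poly (shift c Q) 1"
    by (simp add: poly_altdef)
  finally show ?thesis by (simp add: poly_shift_1)
qed

subsection \<open>Weights and plethystic exponentials\<close>

definition wt :: "(nat \<Rightarrow>\<^sub>0 nat) \<Rightarrow> nat" where
  "wt m = (\<Sum>i\<in>Poly_Mapping.keys m. Suc i * Poly_Mapping.lookup m i)"

lemma wt_add: "wt (m + n) = wt m + wt n"
  unfolding wt_def by (rule setsum_keys_plus_distrib) (simp_all add: algebra_simps)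

lemma wt_single: "wt (Poly_Mapping.single i k) = Suc i * k"
  by (simp add: wt_def)

text \<open>A lower bound on degrees, with p_k of degree k. The element 0 meets every bound, so the
  property survives cancellation in sums.\<close>

definition wt_ge :: "nat \<Rightarrow> symf \<Rightarrow> bool" where
  "wt_ge n P \<longleftrightarrow> (\<forall>m\<in>Poly_Mapping.keys P. n \<le> wt m)"

lemma wt_ge_0 [simp]: "wt_ge n 0" "wt_ge 0 P"
  by (simp_all add: wt_ge_def)

lemma wt_ge_add: "wt_ge n P \<Longrightarrow> wt_ge n Q \<Longrightarrow> wt_ge n (P + Q)"
  using keys_add[of P Q] by (auto simp: wt_ge_def)

lemma wt_ge_sum: "(\<And>x. x \<in> A \<Longrightarrow> wt_ge n (f x)) \<Longrightarrow> wt_ge n (\<Sum>x\<in>A. f x)"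
  by (induction A rule: infinite_finite_induct) (auto intro: wt_ge_add)

lemma wt_ge_mult: "wt_ge n P \<Longrightarrow> wt_ge k Q \<Longrightarrow> wt_ge (n + k) (P * Q)"
  using keys_mult[of P Q] by (fastforce simp: wt_ge_def wt_add intro: add_mono)

lemma wt_ge_cst_mult: "wt_ge n P \<Longrightarrow> wt_ge n (cst c * P)"
  using wt_ge_mult[of 0 "cst c" n P] by simp

lemma wt_ge_psum: "k > 0 \<Longrightarrow> wt_ge k (psum k)"
  by (simp add: wt_ge_def psum_def pmono_def wt_single)

lemma wt_ge_power: "wt_ge n P \<Longrightarrow> wt_ge (k * n) (P ^ k)"
  by (induction k) (auto intro: wt_ge_mult)

lemma wt_ge_prod: "(\<And>x. x \<in> A \<Longrightarrow> wt_ge (g x) (f x)) \<Longrightarrow> wt_ge (\<Sum>x\<in>A. g x) (\<Prod>x\<in>A. f x)"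
  by (induction A rule: infinite_finite_induct) (auto intro: wt_ge_mult)

lemma padj_eq_0:
  assumes "wt_ge n P" "\<And>m. m \<in> Poly_Mapping.keys Q \<Longrightarrow> wt m < n"
  shows "padj P Q = 0"
  unfolding padj_def
proof (rule sum.neutral, rule ballI)
  fix m assume "m \<in> Poly_Mapping.keys P"
  hence "n \<le> wt m" using assms by (auto simp: wt_ge_def)
  hence "m + k \<notin> Poly_Mapping.keys Q" for k
    using assms(2)[of "m + k"] by (auto simp: wt_add)
  hence "pmono_adj m Q = 0"
    by (intro poly_mapping_eqI) (simp add: lookup_pmono_adj in_keys_iff)
  thus "cst (Poly_Mapping.lookup P m) * pmono_adj m Q = 0" by simp
qed

text \<open>The adjoint of an element of weight at least n lowers weights by at least n, so it
  annihilates Q once n exceeds all weights in Q; their sum serves as a bound. This makes the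
  infinite operator sums finite on each argument.\<close>

lemma ex_padj_eq_0: "\<exists>N. \<forall>n\<ge>N. \<forall>P. wt_ge n P \<longrightarrow> padj P Q = 0"
proof (intro exI allI impI)
  fix n P assume "Suc (\<Sum>m\<in>Poly_Mapping.keys Q. wt m) \<le> n" "wt_ge n P"
  show "padj P Q = 0"
  proof (rule padj_eq_0[OF \<open>wt_ge n P\<close>])
    fix m assume "m \<in> Poly_Mapping.keys Q"
    hence "wt m \<le> (\<Sum>m\<in>Poly_Mapping.keys Q. wt m)"
      by (intro member_le_sum) auto
    thus "wt m < n" using \<open>Suc _ \<le> n\<close> by simp
  qed
qed

section \<open>Adams operations and the plethystic exponential\<close>

lemma comm_ring_hom_adams: "comm_ring_hom (adams k)"
  unfolding adams_def
  by (intro comm_ring_hom_psubst)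
     (unfold_locales, simp_all add: pcompose_1 pcompose_add pcompose_mult cst.hom_add cst.hom_mult)

interpretation adams: comm_ring_hom "adams k"
  by (rule comm_ring_hom_adams)

lemma adams_psum: "j > 0 \<Longrightarrow> adams k (psum j) = psum (j * k)"
  by (simp add: adams_def psubst_psum pcompose_1)

lemma wt_ge_adams:
  assumes "k > 0" "wt_ge n P"
  shows "wt_ge (k * n) (adams k P)"
proof -
  have "wt_ge (k * n) (cst (pcompose (Poly_Mapping.lookup P m) (Polynomial.monom 1 k)) * monom_val (\<lambda>j. psum (j * k)) m)"
    if "m \<in> Poly_Mapping.keys P" for m
  proof (rule wt_ge_cst_mult)
    have "wt_ge (\<Sum>i\<in>Poly_Mapping.keys m. Poly_Mapping.lookup m i * (Suc i * k)) (monom_val (\<lambda>j. psum (j * k)) m)"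
      unfolding monom_val_def
      by (intro wt_ge_prod wt_ge_power wt_ge_psum) (use \<open>k > 0\<close> in auto)
    moreover have "(\<Sum>i\<in>Poly_Mapping.keys m. Poly_Mapping.lookup m i * (Suc i * k)) = k * wt m"
      by (simp add: wt_def sum_distrib_left algebra_simps)
    moreover have "n \<le> wt m" using assms that by (auto simp: wt_ge_def)
    hence "k * n \<le> k * wt m" by simp
    ultimately show "wt_ge (k * n) (monom_val (\<lambda>j. psum (j * k)) m :: symf)"
      unfolding wt_ge_def by (metis order_trans)
  qed
  thus ?thesis unfolding adams_def psubst_monom_val by (intro wt_ge_sum)
qed

definition log_Omega :: "symf fps \<Rightarrow> symf fps" where
  "log_Omega A = Abs_fps (\<lambda>n. \<Sum>k=1..n. cst [:1 / of_nat k:] * fps_nth (adams_fps k A) n)"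

lemma adams_fps_add: "adams_fps k (A + B) = adams_fps k A + adams_fps k B"
  by (rule fps_ext) (simp add: adams_fps_def adams.hom_add)

lemma log_Omega_add: "log_Omega (A + B) = log_Omega A + log_Omega B"
  by (rule fps_ext) (simp add: log_Omega_def adams_fps_add distrib_left sum.distrib)

definition fps_exp_cst :: "symf fps" where
  "fps_exp_cst = Abs_fps (\<lambda>n. cst [:1 / fact n:])"

lemma fps_deriv_fps_exp_cst: "fps_deriv fps_exp_cst = fps_exp_cst"
proof (rule fps_ext)
  fix n
  have "of_nat (Suc n) * cst [:1 / fact (Suc n) :: rat:] = cst (of_nat (Suc n) * [:1 / fact (Suc n):])"
    by (simp only: cst.hom_mult cst.hom_of_nat)
  also have "\<dots> = cst [:1 / fact n:]"
    by (simp add: of_nat_poly field_simps del: of_nat_Suc)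
  finally show "fps_nth (fps_deriv fps_exp_cst) n = fps_nth fps_exp_cst n"
    by (simp add: fps_exp_cst_def del: of_nat_Suc)
qed

lemma Omega_eq: "Omega A = fps_compose fps_exp_cst (log_Omega A)"
  by (simp add: Omega_def fps_exp_cst_def log_Omega_def)

lemma fps_deriv_Omega: "fps_deriv (Omega A) = Omega A * fps_deriv (log_Omega A)"
  unfolding Omega_eq
  by (subst fps_compose_deriv) (simp_all add: fps_deriv_fps_exp_cst log_Omega_def)

lemma Omega_nth_0: "fps_nth (Omega A) 0 = 1"
  by (simp add: Omega_eq fps_exp_cst_def flip: one_pCons)

text \<open>Comparison of coefficients in \<open>fps_deriv_Omega\<close>; it gives access to the
  coefficients of \<open>Omega\<close> without expanding the composition of series.\<close>

lemma Omega_recursion: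
  "of_nat n * fps_nth (Omega A) n = (\<Sum>k=1..n. of_nat k * fps_nth (log_Omega A) k * fps_nth (Omega A) (n - k))"
proof (cases n)
  case (Suc n')
  have "of_nat n * fps_nth (Omega A) n = fps_nth (fps_deriv (Omega A)) n'"
    by (simp add: Suc)
  also have "\<dots> = (\<Sum>i=0..n'. fps_nth (Omega A) i * (of_nat (Suc (n' - i)) * fps_nth (log_Omega A) (Suc (n' - i))))"
    unfolding fps_deriv_Omega fps_mult_nth by simp
  also have "\<dots> = (\<Sum>k=1..n. of_nat k * fps_nth (log_Omega A) k * fps_nth (Omega A) (n - k))"
    by (rule sum.reindex_bij_witness[of _ "\<lambda>k. n - k" "\<lambda>i. n - i"])
       (auto simp: Suc Suc_diff_le)
  finally show ?thesis .
qed simp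

lemma fps_linear_ode_unique:
  fixes F G L :: "symf fps"
  assumes "fps_deriv F = F * L" "fps_deriv G = G * L" "fps_nth F 0 = fps_nth G 0"
  shows "F = G"
proof (rule fps_ext)
  fix n
  show "fps_nth F n = fps_nth G n"
  proof (induction n rule: less_induct)
    case (less n)
    show ?case
    proof (cases n)
      case (Suc m)
      have "of_nat n * fps_nth F n = fps_nth (F * L) m" "of_nat n * fps_nth G n = fps_nth (G * L) m"
        using assms(1,2)[THEN arg_cong[of _ _ "\<lambda>F. fps_nth F m"]] by (simp_all add: Suc)
      moreover have "fps_nth (F * L) m = fps_nth (G * L) m"
        unfolding fps_mult_nth by (rule sum.cong) (use less Suc in auto)
      ultimately have "of_nat n * fps_nth F n = of_nat n * fps_nth G n" by simp
      thus ?thesis using Suc by (simp only: mult_cancel_left of_nat_eq_0_iff) simp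
    qed (simp add: assms(3))
  qed
qed

text \<open>Both sides solve the linear equation F' = F L' with L =
  \<open>log_Omega (A + B)\<close>, and both have constant term 1.\<close>

lemma Omega_add: "Omega (A + B) = Omega A * Omega B"
proof (rule fps_linear_ode_unique)
  show "fps_deriv (Omega (A + B)) = Omega (A + B) * fps_deriv (log_Omega (A + B))"
    by (rule fps_deriv_Omega)
  show "fps_deriv (Omega A * Omega B) = (Omega A * Omega B) * fps_deriv (log_Omega (A + B))"
    by (simp add: fps_deriv_Omega log_Omega_add algebra_simps)
qed (simp add: Omega_nth_0)

definition fps_wt_ge :: "symf fps \<Rightarrow> bool" where
  "fps_wt_ge F \<longleftrightarrow> (\<forall>n. wt_ge n (fps_nth F n))"

lemma fps_wt_ge_add: "fps_wt_ge F \<Longrightarrow> fps_wt_ge G \<Longrightarrow> fps_wt_ge (F + G)"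
  by (simp add: fps_wt_ge_def wt_ge_add)

lemma fps_wt_ge_mult:
  assumes "fps_wt_ge F" "fps_wt_ge G"
  shows "fps_wt_ge (F * G)"
  unfolding fps_wt_ge_def fps_mult_nth
proof (intro allI wt_ge_sum)
  fix n i :: nat assume "i \<in> {0..n}"
  with assms wt_ge_mult[of i "fps_nth F i" "n - i" "fps_nth G (n - i)"] show "wt_ge n (fps_nth F i * fps_nth G (n - i))"
    by (auto simp: fps_wt_ge_def)
qed

text \<open>By \<open>Omega_recursion\<close>, n times the n-th coefficient is a sum of products of
  factors of weight at least k and n - k. Multiplying by the constant 1/n keeps the bound.\<close>

lemma fps_wt_ge_Omega:
  assumes "fps_wt_ge A"
  shows "fps_wt_ge (Omega A)"
proof -
  have adams: "wt_ge n (fps_nth (adams_fps k A) n)" if "k > 0" for n k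
    using that assms wt_ge_adams[of k "n div k" "fps_nth A (n div k)"]
    by (auto simp: adams_fps_def fps_wt_ge_def)
  have log: "wt_ge n (fps_nth (log_Omega A) n)" for n
    by (auto simp: log_Omega_def intro!: wt_ge_sum wt_ge_cst_mult adams)
  have "wt_ge n (fps_nth (Omega A) n)" for n
  proof (induction n rule: less_induct)
    case (less n)
    show ?case
    proof (cases "n = 0")
      case False
      have "wt_ge n (\<Sum>k=1..n. of_nat k * fps_nth (log_Omega A) k * fps_nth (Omega A) (n - k))"
      proof (rule wt_ge_sum)
        fix k assume k: "k \<in> {1..n}"
        hence "wt_ge (k + (n - k)) (fps_nth (log_Omega A) k * fps_nth (Omega A) (n - k))"
          by (intro wt_ge_mult log less.IH) auto
        with k show "wt_ge n (of_nat k * fps_nth (log_Omega A) k * fps_nth (Omega A) (n - k))"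
          using wt_ge_cst_mult[of n _ "of_nat k"] by (simp add: cst.hom_of_nat mult.assoc)
      qed
      hence "wt_ge n (of_nat n * fps_nth (Omega A) n)" by (simp only: Omega_recursion)
      moreover have "cst [:1 / of_nat n:] * (of_nat n * fps_nth (Omega A) n) = fps_nth (Omega A) n"
      proof -
        have "cst [:1 / of_nat n:] * of_nat n = cst ([:1 / of_nat n :: rat:] * of_nat n)"
          by (simp only: cst.hom_mult cst.hom_of_nat)
        also have "\<dots> = 1" using False by (simp add: of_nat_poly flip: one_pCons)
        finally show ?thesis by (simp only: mult.assoc[symmetric] mult_1_left)
      qed
      ultimately show ?thesis using wt_ge_cst_mult by metis
    qed simp
  qed
  thus ?thesis by (simp add: fps_wt_ge_def)
qed

lemma comm_ring_hom_graded: "comm_ring_hom graded"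
  unfolding graded_def
  by (intro comm_ring_hom_psubst) (unfold_locales, simp_all add: cst.hom_add cst.hom_mult)

interpretation graded: comm_ring_hom graded
  by (rule comm_ring_hom_graded)

lemma graded_cst: "graded (cst c) = fps_const (cst c)"
  by (simp add: graded_def psubst_cst)

lemma graded_psum: "k > 0 \<Longrightarrow> graded (psum k) = fps_const (psum k) * fps_X ^ k"
  by (simp add: graded_def psubst_psum)

lemma fps_wt_ge_graded: "fps_wt_ge (graded P)"
proof (induction P rule: power_sum_induct)
  case (psum k)
  then show ?case by (simp add: graded_psum fps_wt_ge_def fps_X_power_mult_nth wt_ge_psum mult.commute[of "fps_const _"])
qed (simp_all add: graded_cst graded.hom_add graded.hom_mult fps_wt_ge_add fps_wt_ge_mult, simp add: fps_wt_ge_def)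

subsection \<open>Orthonormality of the Schur functions\<close>

lemma graded_nth: 
  assumes "j > 0"
  shows "fps_nth (graded (cst c * psum j)) n = (if n = j then cst c * psum j else 0)"
  using assms by (simp add: graded.hom_mult graded_cst graded_psum mult.assoc[symmetric] fps_X_power_mult_right_nth)

lemma adams_cst: "adams k (cst [:e:]) = cst [:e:]"
  by (simp add: adams_def psubst_cst)

text \<open>Since e is rational, p_k[e z^j p_j] = e z^(jk) p_(jk). Hence for n = jk the coefficient
  of z^n is e p_n / k, and n / k = j.\<close>

lemma log_Omega_psum:
  assumes "j > 0" "n > 0"
  shows "of_nat n * fps_nth (log_Omega (graded (cst [:e:] * psum j))) n
    = cst [:if j dvd n then of_nat j * e else 0:] * psum n"
proof -
  have *: "fps_nth (adams_fps k (graded (cst [:e:] * psum j))) n = (if n = k * j then cst [:e:] * psum n else 0)"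
    if "k > 0" for k
  proof (cases "n = k * j")
    case True
    then show ?thesis using that assms
      by (simp add: adams_fps_def graded_nth adams.hom_mult adams_psum adams_cst mult.commute[of j k])
  next
    case False
    then show ?thesis using that assms by (auto simp: adams_fps_def graded_nth)
  qed
  have "fps_nth (log_Omega (graded (cst [:e:] * psum j))) n
      = (\<Sum>k=1..n. if n = k * j then cst [:1 / of_nat k:] * (cst [:e:] * psum n) else 0)"
    unfolding log_Omega_def fps_nth_Abs_fps by (rule sum.cong) (auto simp: *)
  also have "\<dots> = (if j dvd n then cst [:1 / of_nat (n div j):] * (cst [:e:] * psum n) else 0)"
  proof (cases "j dvd n")
    case True
    then obtain k where k: "n = k * j" by (metis dvd_div_mult_self)
    have "(\<Sum>k'=1..n. if n = k' * j then cst [:1 / of_nat k':] * (cst [:e:] * psum n) else 0)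
       = (\<Sum>k'=1..n. if k' = k then cst [:1 / of_nat k:] * (cst [:e:] * psum n) else (0::symf))"
      using assms by (intro sum.cong) (auto simp: k)
    also have "\<dots> = cst [:1 / of_nat k:] * (cst [:e:] * psum n)"
      using assms k by (simp add: sum.delta)
    finally show ?thesis using k assms by simp
  qed (auto intro!: sum.neutral)
  also have "of_nat n * \<dots> = cst [:if j dvd n then of_nat j * e else 0:] * psum n"
  proof (cases "j dvd n")
    case True
    have "of_nat n * (cst [:1 / of_nat (n div j):] * (cst [:e:] * psum n))
        = cst (of_nat n * [:1 / of_nat (n div j):] * [:e:]) * (psum n :: symf)"
      by (simp only: cst.hom_mult cst.hom_of_nat mult.assoc)
    also have "of_nat n * [:1 / of_nat (n div j):] * [:e:] = [:of_nat j * e :: rat:]"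
      using True assms by (auto simp: of_nat_poly elim!: dvdE)
    finally show ?thesis using True by simp
  qed simp
  finally show ?thesis .
qed

lemma Omega_psum_recursion:
  assumes "j > 0"
  shows "of_nat n * fps_nth (Omega (graded (cst [:e:] * psum j))) n
    = (\<Sum>i=1..n. cst [:if j dvd i then of_nat j * e else 0:] * psum i
        * fps_nth (Omega (graded (cst [:e:] * psum j))) (n - i))"
  unfolding Omega_recursion[of n] by (rule sum.cong) (auto simp: log_Omega_psum[OF assms])

lemma hsym_eq_Omega: "hsym (int n) = fps_nth (Omega (graded (cst [:1:] * psum 1))) n"
proof -
  have "graded (cst [:1:] * psum 1) = fps_X * fps_const (psum 1)"
    by (simp add: graded_psum mult.commute flip: one_pCons)
  thus ?thesis by (simp add: hsym_def)
qed

lemma hsym_0 [simp]: "hsym 0 = 1"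
  using hsym_eq_Omega[of 0] by (simp add: Omega_nth_0)

lemma hsym_neg [simp]: "r < 0 \<Longrightarrow> hsym r = 0"
  by (simp add: hsym_def)

text \<open>Newton's identity, which is the case j = e = 1 of
  \<open>Omega_psum_recursion\<close>.\<close>

lemma Newton_hsym: "of_nat n * hsym (int n) = (\<Sum>i=1..n. psum i * hsym (int n - int i))"
proof -
  have "of_nat n * hsym (int n) = (\<Sum>i=1..n. cst [:1:] * psum i * hsym (int (n - i)))"
    unfolding hsym_eq_Omega by (subst Omega_psum_recursion) simp_all
  also have "\<dots> = (\<Sum>i=1..n. psum i * hsym (int n - int i))"
    by (rule sum.cong) (simp_all add: of_nat_diff flip: one_pCons)
  finally show ?thesis .
qed

lemma padj_hsym: "padj (hsym (int n)) Q = coeff (shift (\<lambda>_. 1) Q) n"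
proof (rule padj_eq_coeff_shift)
  fix n :: nat
  show "of_nat n * hsym (int n) = (\<Sum>i=1..n. cst [:1:] * psum i * hsym (int (n - i)))"
    unfolding Newton_hsym by (rule sum.cong) (simp_all add: of_nat_diff flip: one_pCons)
qed simp

text \<open>Apply the derivation to Newton's identity and use induction: the terms p_j h_(n-i-j) sum
  to (n-i) h_(n-i), and j = i adds i h_(n-i). For i > n everything vanishes.\<close>

lemma padj_psum_hsym:
  assumes "i > 0" shows "padj (psum i) (hsym r) = hsym (r - int i)"
proof -
  have "padj (psum i) (hsym (int n)) = hsym (int n - int i)" for n
  proof (induction n rule: less_induct)
    case (less n)
    show ?case
    proof (cases "n = 0")
      case True
      then show ?thesis using padj_psum_cst[OF assms, of 1] assms by simp
    next
      case False
      have "of_nat n * padj (psum i) (hsym (int n)) = padj (psum i) (of_nat n * hsym (int n))"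
        using padj_cst_right[of _ "of_nat n"] by (simp only: cst.hom_of_nat)
      also have "\<dots> = (\<Sum>j=1..n. padj (psum i) (psum j * hsym (int (n - j))))"
        unfolding Newton_hsym padj_sum_right by (rule sum.cong) (auto simp: of_nat_diff)
      also have "\<dots> = (\<Sum>j=1..n. psum j * hsym (int n - int i - int j) + (if j = i then of_nat i * hsym (int n - int i) else 0))"
      proof (rule sum.cong)
        fix j assume j: "j \<in> {1..n}"
        hence "padj (psum i) (hsym (int (n - j))) = hsym (int n - int i - int j)"
          by (subst less.IH) (auto simp: of_nat_diff algebra_simps)
        with j show "padj (psum i) (psum j * hsym (int (n - j))) =
            psum j * hsym (int n - int i - int j) + (if j = i then of_nat i * hsym (int n - int i) else 0)"
          by (auto simp: padj_psum_psum_mult assms simp del: of_nat_diff) (simp add: of_nat_diff)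
      qed simp
      also have "\<dots> = (\<Sum>j=1..n. psum j * hsym (int n - int i - int j)) + (if i \<le> n then of_nat i * hsym (int n - int i) else 0)"
        using assms by (simp add: sum.distrib sum.delta')
      also have "\<dots> = of_nat n * hsym (int n - int i)"
      proof (cases "i \<le> n")
        case True
        have "(\<Sum>j=1..n. psum j * hsym (int n - int i - int j)) = (\<Sum>j=1..n-i. psum j * hsym (int (n - i) - int j))"
          by (rule sum.mono_neutral_cong_right) (use True in \<open>auto simp: of_nat_diff\<close>)
        also have "\<dots> = of_nat (n - i) * hsym (int (n - i))"
          by (simp only: Newton_hsym)
        finally show ?thesis using True by (simp add: of_nat_diff algebra_simps)
      qed simp
      finally show ?thesis using False by simp
    qed
  qed
  from this[of "nat r"] show ?thesis by (cases "r < 0") auto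
qed

text \<open>By induction all k summands of \<open>coeff_shift_recursion\<close> equal h_(r-k), so
  the factor k cancels. This is h_r[X+z] = sum_k z^k h_(r-k).\<close>

lemma coeff_shift_hsym: "coeff (shift (\<lambda>_. 1) (hsym r)) k = hsym (r - int k)"
proof (induction k arbitrary: r rule: less_induct)
  case (less k)
  show ?case
  proof (cases "k = 0")
    case False
    have "of_nat k * coeff (shift (\<lambda>_. 1) (hsym r)) k
        = (\<Sum>i=1..k. cst [:1:] * coeff (shift (\<lambda>_. 1) (hsym (r - int i))) (k - i))"
      unfolding coeff_shift_recursion by (rule sum.cong) (auto simp: padj_psum_hsym)
    also have "\<dots> = (\<Sum>i=1..k. hsym (r - int k))"
      by (rule sum.cong) (auto simp: less.IH of_nat_diff simp flip: one_pCons)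
    also have "\<dots> = of_nat k * hsym (r - int k)" by simp
    finally show ?thesis using False by simp
  qed (simp add: coeff_shift_0)
qed

text \<open>Iteration of G_(a+1) = z G_a + h_(a+1), where G_a is the shift of h_a. It supplies the
  coefficients of the column operations in \<open>coeff_shift_schur\<close>.\<close>

lemma shift_hsym_add: 
  "shift (\<lambda>_. 1) (hsym (a + int j)) = Polynomial.monom 1 j * shift (\<lambda>_. 1) (hsym a)
     + (\<Sum>l=1..j. Polynomial.monom 1 (j - l) * [:hsym (a + int l):])"
proof (induction j)
  case (Suc j)
  have "shift (\<lambda>_. 1) (hsym (a + int (Suc j))) = Polynomial.monom 1 1 * shift (\<lambda>_. 1) (hsym (a + int j)) + [:hsym (a + int (Suc j)):]"
    by (rule poly_eqI) (auto simp: coeff_shift_hsym coeff_monom_mult coeff_pCons algebra_simps split: nat.split)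
  also have "\<dots> = Polynomial.monom 1 (Suc j) * shift (\<lambda>_. 1) (hsym a)
     + (\<Sum>l=1..j. Polynomial.monom 1 (Suc j - l) * [:hsym (a + int l):]) + [:hsym (a + int (Suc j)):]"
    unfolding Suc distrib_left sum_distrib_left mult.assoc[symmetric] mult_monom
    by (intro arg_cong2[of _ _ _ _ "(+)"] refl sum.cong) (auto simp: Suc_diff_le)
  finally show ?case by (simp add: add.assoc)
qed simp

section \<open>Jacobi-Trudi determinants and removal of the first row\<close>

definition JT :: "nat list \<Rightarrow> symf mat" where
  "JT lam = mat (length lam) (length lam) (\<lambda>(i, j). hsym (int (lam ! i) - int i + int j))"

lemma schur_JT: "schur lam = Determinant.det (JT lam)"
  by (simp add: schur_def JT_def)

lemma det_const_poly: "Determinant.det (map_mat (\<lambda>x. [:x:]) A) = [:Determinant.det (A :: 'c::comm_ring_1 mat):]"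
proof -
  interpret comm_ring_hom "\<lambda>x :: 'c. [:x:]"
    by unfold_locales (simp_all flip: one_pCons)
  show ?thesis by simp
qed

text \<open>
  With \<open>G\<^sub>a = \<Sum>k. z\<^sup>k h\<^sub>a\<^sub>-\<^sub>k\<close> one has \<open>G\<^sub>a\<^sub>+\<^sub>1 = z G\<^sub>a + h\<^sub>a\<^sub>+\<^sub>1\<close>, so that unipotent column operations remove \<open>z\<close>
  from all columns of the shifted matrix except the first.
\<close>

lemma coeff_shift_schur:
  assumes "lam \<noteq> []"
  shows "coeff (shift (\<lambda>_. 1) (schur lam)) m =
    (\<Sum>i<length lam. hsym (int (lam ! i) - int i - int m) * cofactor (JT lam) i 0)"
proof -
  define n where "n = length lam"
  let ?G = "\<lambda>r. shift (\<lambda>_. 1) (hsym r)"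
  define M where "M = mat n n (\<lambda>(i, j). ?G (int (lam ! i) - int i + int j))"
  define N where "N = mat n n (\<lambda>(i, j). if j = 0 then ?G (int (lam ! i) - int i) else [:hsym (int (lam ! i) - int i + int j):])"
  define U where "U = mat n n (\<lambda>(l, j). if l \<le> j then Polynomial.monom (1::symf) (j - l) else 0)"
  have car: "N \<in> carrier_mat n n" "U \<in> carrier_mat n n"
    by (simp_all add: N_def U_def)
  have "n > 0" using assms by (simp add: n_def)
  have "shift (\<lambda>_. 1) (schur lam) = Determinant.det M"
  proof -
    have "M = map_mat (shift (\<lambda>_. 1)) (JT lam)"
      by (rule eq_matI) (auto simp: M_def JT_def n_def)
    thus ?thesis by (simp add: schur_JT)
  qed
  also have "M = N * U"
  proof (rule eq_matI)
    fix i j assume "i < dim_row (N * U)" "j < dim_col (N * U)"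
    hence ij: "i < n" "j < n" using car by auto
    let ?a = "int (lam ! i) - int i"
    have "(N * U) $$ (i, j) = (\<Sum>l=0..<n. N $$ (i, l) * U $$ (l, j))"
      using ij car by (simp add: scalar_prod_def)
    also have "\<dots> = (\<Sum>l\<in>insert 0 {1..j}. N $$ (i, l) * U $$ (l, j))"
      by (rule sum.mono_neutral_right) (use ij in \<open>auto simp: U_def\<close>)
    also have "\<dots> = ?G ?a * Polynomial.monom 1 j + (\<Sum>l=1..j. [:hsym (?a + int l):] * Polynomial.monom 1 (j - l))"
      using ij \<open>n > 0\<close> by (subst sum.insert) (auto simp: N_def U_def intro!: sum.cong)
    also have "\<dots> = M $$ (i, j)"
      using ij by (simp add: M_def shift_hsym_add mult.commute)
    finally show "M $$ (i, j) = (N * U) $$ (i, j)" ..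
  qed (use car in \<open>auto simp: M_def\<close>)
  also have "Determinant.det (N * U) = Determinant.det N"
  proof -
    have "Determinant.det U = prod_list (diag_mat U)"
      by (rule det_upper_triangular[OF _ car(2)]) (auto simp: upper_triangular_def U_def)
    also have "\<dots> = 1"
      by (simp add: prod_list_diag_prod U_def)
    finally show ?thesis using det_mult[OF car] by simp
  qed
  \<comment> \<open>Only column 0 of \<open>N\<close> involves z, so its cofactors are constant in z
    and agree with those of \<open>JT lam\<close>.\<close>
  also have "\<dots> = (\<Sum>i<n. N $$ (i, 0) * cofactor N i 0)"
    by (rule laplace_expansion_column[OF car(1) \<open>n > 0\<close>])
  also have "\<dots> = (\<Sum>i<n. ?G (int (lam ! i) - int i) * [:cofactor (JT lam) i 0:])"
  proof (rule sum.cong)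
    fix i assume i: "i \<in> {..<n}"
    have "mat_delete N i 0 = map_mat (\<lambda>x. [:x:]) (mat_delete (JT lam) i 0)"
      by (rule eq_matI) (auto simp: N_def JT_def mat_delete_def n_def)
    hence "cofactor N i 0 = (- 1) ^ i * [:Determinant.det (mat_delete (JT lam) i 0):]"
      by (simp add: cofactor_def det_const_poly)
    also have "\<dots> = [:cofactor (JT lam) i 0:]"
      by (cases "even i") (simp_all add: cofactor_def)
    finally show "N $$ (i, 0) * cofactor N i 0 = ?G (int (lam ! i) - int i) * [:cofactor (JT lam) i 0:]"
      using i \<open>n > 0\<close> by (simp add: N_def)
  qed simp
  finally show ?thesis
    by (simp add: coeff_sum coeff_shift_hsym n_def mult.commute)
qed

lemma mat_delete_JT: "mat_delete (JT (r # lam)) 0 0 = JT lam"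
  by (rule eq_matI) (auto simp: JT_def mat_delete_def algebra_simps)

lemma cofactor_JT: "cofactor (JT (r # lam)) 0 0 = schur lam"
  by (simp add: cofactor_def mat_delete_JT schur_JT)

lemma schur_Nil [simp]: "schur [] = 1"
  by (simp add: schur_def)

lemma is_partition_Cons: "is_partition (r # lam) \<longleftrightarrow> r > 0 \<and> (\<forall>x\<in>set lam. x \<le> r) \<and> is_partition lam"
  by (auto simp: is_partition_def)

text \<open>For m >= q, every index \<open>lam ! i - i - m\<close> in
  \<open>coeff_shift_schur\<close> is negative unless i = 0 and m = q; there the entry is h_0 = 1
  and the cofactor is \<open>schur mu\<close>.\<close>

lemma padj_hsym_schur:
  assumes "is_partition (q # mu)" "q \<le> m"
  shows "padj (hsym (int m)) (schur (q # mu)) = (if m = q then schur mu else 0)"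
proof -
  have "hsym (int ((q # mu) ! i) - int i - int m) * cofactor (JT (q # mu)) i 0 = (if i = 0 \<and> m = q then schur mu else 0)"
    if "i < length (q # mu)" for i
  proof -
    have "(q # mu) ! i \<le> q" using that assms by (cases i) (auto simp: is_partition_Cons)
    then show ?thesis using assms by (cases "i = 0"; cases "m = q") (auto simp: cofactor_JT)
  qed
  hence "coeff (shift (\<lambda>_. 1) (schur (q # mu))) m = (\<Sum>i<length (q # mu). if i = 0 \<and> m = q then schur mu else 0)"
    by (subst coeff_shift_schur) (auto intro!: sum.cong)
  also have "\<dots> = (if m = q then schur mu else 0)"
    by (cases "m = q") (simp_all add: sum.delta')
  finally show ?thesis by (simp add: padj_hsym)
qed

lemma padj_hsym_1: "m > 0 \<Longrightarrow> padj (hsym (int m)) 1 = 0"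
  by (simp add: padj_hsym)

text \<open>Laplace expansion along the first row, whose entries are h_r, h_(r+1), and so on. The
  cofactors are hidden behind c because only c 0 survives in the pairings.\<close>

lemma schur_Cons:
  "\<exists>c. c 0 = schur lam \<and> schur (r # lam) = (\<Sum>i<Suc (length lam). hsym (int (r + i)) * c i)"
proof (intro exI conjI)
  let ?n = "length (r # lam)"
  have "schur (r # lam) = (\<Sum>j<?n. JT (r # lam) $$ (0, j) * cofactor (JT (r # lam)) 0 j)"
    unfolding schur_JT by (rule laplace_expansion_row) (auto simp: JT_def)
  also have "\<dots> = (\<Sum>i<Suc (length lam). hsym (int (r + i)) * cofactor (JT (r # lam)) 0 i)"
    by (rule sum.cong) (auto simp: JT_def[of "r # lam", THEN arg_cong[of _ _ "\<lambda>A. A $$ _"]])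
  finally show "schur (r # lam) = (\<Sum>i<Suc (length lam). hsym (int (r + i)) * cofactor (JT (r # lam)) 0 i)" .
qed (rule cofactor_JT)

text \<open>Moving h_(r+i) to the other side gives an adjoint of index r + i >= q, which by
  \<open>padj_hsym_schur\<close> is nonzero only for i = 0 and q = r.\<close>

lemma pform_schur_Cons:
  assumes "is_partition (r # lam)" "is_partition (q # mu)" "q \<le> r"
  shows "pform (schur (r # lam)) (schur (q # mu)) = (if q = r then pform (schur lam) (schur mu) else 0)"
proof -
  obtain c where c: "c 0 = schur lam" "schur (r # lam) = (\<Sum>i<Suc (length lam). hsym (int (r + i)) * c i)"
    using schur_Cons by blast
  have "pform (schur (r # lam)) (schur (q # mu)) = 
      (\<Sum>i<Suc (length lam). pform (c i) (padj (hsym (int (r + i))) (schur (q # mu))))"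
    by (simp only: c(2) pform_sum_left pform_padj)
  also have "\<dots> = (\<Sum>i<Suc (length lam). if i = 0 then (if q = r then pform (schur lam) (schur mu) else 0) else 0)"
    using assms by (intro sum.cong) (auto simp: padj_hsym_schur c(1) simp del: of_nat_add)
  finally show ?thesis by (simp add: sum.delta')
qed

lemma pform_schur_Nil:
  assumes "is_partition (r # lam)"
  shows "pform (schur (r # lam)) 1 = 0"
proof -
  obtain c where c: "schur (r # lam) = (\<Sum>i<Suc (length lam). hsym (int (r + i)) * c i)"
    using schur_Cons by blast
  show ?thesis
    using assms by (simp only: c pform_sum_left flip: pform_padj)
     (simp add: padj_hsym_1 is_partition_Cons del: of_nat_add)
qed

lemma pform_schur:
  assumes "is_partition lam" "is_partition mu"
  shows "pform (schur lam) (schur mu) = (if lam = mu then 1 else 0)"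
  using assms
proof (induction lam arbitrary: mu)
  case Nil
  show ?case
  proof (cases mu)
    case Nil
    then show ?thesis by (simp add: pform_def)
  next
    case (Cons q beta)
    then show ?thesis using pform_schur_Nil[of q beta] Nil.prems by (simp add: pform_commute[of 1])
  qed
next
  case (Cons r alpha)
  show ?case
  proof (cases mu)
    case Nil
    then show ?thesis using pform_schur_Nil Cons.prems by simp
  next
    case mu: (Cons q beta)
    have "pform (schur alpha) (schur beta) = (if alpha = beta then 1 else 0)"
      using Cons mu by (intro Cons.IH) (auto simp: is_partition_Cons)
    \<comment> \<open>The determinant with the larger first part has to be expanded, so for q > r
      symmetry of the form exchanges the two arguments.\<close>
    then show ?thesis
      using Cons.prems mu pform_schur_Cons[of r alpha q beta] pform_schur_Cons[of q beta r alpha]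
      by (cases "q \<le> r") (auto simp: pform_commute[of "schur (r # alpha)"])
  qed
qed

subsection \<open>Spanning by the Schur functions\<close>

inductive lin_span :: "symf set \<Rightarrow> symf \<Rightarrow> bool" for B where
  lin_span_0: "lin_span B 0"
| lin_span_step: "lin_span B P \<Longrightarrow> b \<in> B \<Longrightarrow> lin_span B (P + cst a * b)"

lemma lin_span_add: "lin_span B Q \<Longrightarrow> lin_span B P \<Longrightarrow> lin_span B (P + Q)"
  by (induction rule: lin_span.induct) (auto simp: add.assoc[symmetric] intro: lin_span_step)

lemma lin_span_cst_mult: "lin_span B P \<Longrightarrow> lin_span B (cst c * P)"
  by (induction rule: lin_span.induct)
     (auto simp: distrib_left mult.assoc[symmetric] simp flip: cst.hom_mult intro: lin_span.intros)

lemma lin_span_base: "b \<in> B \<Longrightarrow> lin_span B b"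
  using lin_span_step[OF lin_span_0, of b B 1] by simp

lemma lin_span_sum: "(\<And>x. x \<in> A \<Longrightarrow> lin_span B (f x)) \<Longrightarrow> lin_span B (\<Sum>x\<in>A. f x)"
  by (induction A rule: infinite_finite_induct) (auto intro: lin_span_0 lin_span_add)

lemma lin_span_uminus: "lin_span B P \<Longrightarrow> lin_span B (- P)"
  using lin_span_cst_mult[of B P "-1"] by (simp add: cst.hom_uminus)

lemma lin_span_trans:
  assumes "lin_span B P" "\<And>b. b \<in> B \<Longrightarrow> lin_span B' b"
  shows "lin_span B' P"
  using assms(1) by induction (auto intro: lin_span_0 lin_span_add lin_span_cst_mult assms(2))

lemma lin_span_mult:
  assumes "lin_span B P" "lin_span B Q" and B: "\<And>b b'. b \<in> B \<Longrightarrow> b' \<in> B \<Longrightarrow> b * b' \<in> B"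
  shows "lin_span B (P * Q)"
  using assms(1)
proof induction
  case (lin_span_step P b a)
  from assms(2) have "lin_span B (b * Q)"
  proof induction
    case (lin_span_step Q b' a')
    then show ?case using B[OF \<open>b \<in> B\<close>, of b']
      by (simp add: distrib_left mult.left_commute[of b] lin_span.intros)
  qed (simp add: lin_span_0)
  then show ?case using lin_span_step
    by (simp add: distrib_right mult.assoc lin_span_add lin_span_cst_mult)
qed (simp add: lin_span_0)

section \<open>Products of complete symmetric functions\<close>

definition hprod :: "nat list \<Rightarrow> symf" where
  "hprod beta = prod_list (map (\<lambda>b. hsym (int b)) beta)"

lemma hprod_append: "hprod (xs @ ys) = hprod xs * hprod ys"
  by (simp add: hprod_def)

text \<open>Newton's identity solved for p_k involves h_k and p_i h_(k-i) with i < k, and the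
  products \<open>hprod\<close> are closed under multiplication.\<close>

lemma lin_span_hprod: "lin_span (range hprod) P"
proof (induction P rule: power_sum_induct)
  case (cst c)
  have "lin_span (range hprod) (cst c * hprod [])"
    by (intro lin_span_cst_mult lin_span_base) auto
  then show ?case by (simp add: hprod_def)
next
  case (psum k)
  then show ?case
  proof (induction k rule: less_induct)
    case (less k)
    have "of_nat k * hsym (int k) = (\<Sum>i\<in>insert k {1..<k}. psum i * hsym (int k - int i))"
      unfolding Newton_hsym using less.prems by (intro sum.cong) auto
    also have "\<dots> = psum k + (\<Sum>i=1..<k. psum i * hsym (int k - int i))"
      by (subst sum.insert) auto
    finally have eq: "psum k = of_nat k * hsym (int k) + - (\<Sum>i=1..<k. psum i * hsym (int k - int i))"
      by simp
    have h: "lin_span (range hprod) (hsym (int n))" for n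
    proof -
      have "hprod [n] = hsym (int n)" by (simp add: hprod_def)
      thus ?thesis by (metis lin_span_base rangeI)
    qed
    have "lin_span (range hprod) (psum i * hsym (int k - int i))" if "i \<in> {1..<k}" for i
    proof (rule lin_span_mult)
      show "lin_span (range hprod) (hsym (int k - int i))" using h[of "k - i"] that by (simp add: of_nat_diff)
    qed (use that less.IH in \<open>auto simp flip: hprod_append\<close>)
    hence "lin_span (range hprod) (of_nat k * hsym (int k) + - (\<Sum>i=1..<k. psum i * hsym (int k - int i)))"
      using lin_span_cst_mult[OF h, of "of_nat k" k] by (intro lin_span_add lin_span_uminus lin_span_sum) (auto simp: cst.hom_of_nat)
    thus ?case by (simp only: eq[symmetric])
  qed
qed (auto intro: lin_span_add lin_span_mult simp flip: hprod_append)

section \<open>Sums of squares under permuted shifts\<close>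

lemma sum_lessThan_card_le_sum: "finite A \<Longrightarrow> \<Sum>{..<card A} \<le> \<Sum>(A :: nat set)"
proof (induction A rule: finite_linorder_max_induct)
  case (insert b A)
  have "card A \<le> card {..<b}" by (intro card_mono) (use insert in auto)
  moreover have "b \<notin> A" using insert by auto
  ultimately show ?case using insert by simp
qed simp

text \<open>Abel summation as an inequality: the partial sums of c are nonnegative, so replacing f i
  by the next, smaller value cannot increase the product. For n = 0 both sides are 0.\<close>

lemma sum_decreasing_mult_ge:
  fixes f c :: "nat \<Rightarrow> int"
  assumes "\<And>i. Suc i < n \<Longrightarrow> f (Suc i) \<le> f i" "\<And>m. m \<le> n \<Longrightarrow> 0 \<le> (\<Sum>i<m. c i)"
  shows "f (n - 1) * (\<Sum>i<n. c i) \<le> (\<Sum>i<n. f i * c i)"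
  using assms
proof (induction n)
  case (Suc n)
  have "f n * (\<Sum>i<n. c i) \<le> f (n - 1) * (\<Sum>i<n. c i)"
    using Suc.prems(1)[of "n - 1"] Suc.prems(2)[of n] by (cases n) (auto intro: mult_right_mono)
  also have "\<dots> \<le> (\<Sum>i<n. f i * c i)"
    by (rule Suc.IH) (auto intro: Suc.prems)
  finally show ?case by (simp add: algebra_simps)
qed simp

text \<open>With c i = p i - i the right-hand side is the left-hand side plus 2 sum x c plus sum
  c^2. The middle term is nonnegative by Abel summation, and the last is positive because p moves
  some index.\<close>

lemma sum_permuted_squares_less:
  fixes x :: "nat \<Rightarrow> int"
  assumes dec: "\<And>i. Suc i < n \<Longrightarrow> x (Suc i) \<le> x i" and p: "p permutes {..<n}" "p \<noteq> id"
  shows "(\<Sum>i<n. (x i)\<^sup>2) < (\<Sum>i<n. (x i - int i + int (p i))\<^sup>2)"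
proof -
  define c where "c i = int (p i) - int i" for i
  have tot: "(\<Sum>i<n. c i) = 0"
    using sum.permute[OF p(1), of int] by (simp add: c_def sum_subtractf comp_def)
  \<comment> \<open>The values of p on the first m indices are m distinct naturals, so their sum is
    at least 0 + ... + (m-1).\<close>
  have part: "0 \<le> (\<Sum>i<m. c i)" if "m \<le> n" for m
  proof -
    have inj: "inj_on p {..<m}" using p(1) by (simp add: permutes_inj_on)
    have "int (\<Sum>{..<m}) \<le> int (\<Sum>(p ` {..<m}))"
      using sum_lessThan_card_le_sum[of "p ` {..<m}"] inj by (simp add: card_image del: of_nat_sum)
    also have "\<dots> = (\<Sum>i<m. int (p i))"
      by (simp add: sum.reindex[OF inj])
    finally show ?thesis by (simp add: c_def sum_subtractf)
  qed
  have "0 \<le> (\<Sum>i<n. x i * c i)"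
    using sum_decreasing_mult_ge[of n x c, OF dec part] tot by simp
  moreover have "0 < (\<Sum>i<n. (c i)\<^sup>2)"
  proof -
    obtain i where "p i \<noteq> i" using p(2) by (auto simp: fun_eq_iff)
    moreover from this have "i < n" using p(1) by (auto simp: permutes_def)
    ultimately show ?thesis by (intro sum_pos2[of _ i]) (auto simp: c_def)
  qed
  moreover have "(\<Sum>i<n. (x i - int i + int (p i))\<^sup>2) = (\<Sum>i<n. (x i)\<^sup>2) + 2 * (\<Sum>i<n. x i * c i) + (\<Sum>i<n. (c i)\<^sup>2)"
    unfolding sum_distrib_left sum.distrib[symmetric]
    by (rule sum.cong) (auto simp: c_def power2_eq_square algebra_simps)
  ultimately show ?thesis by simp
qed

lemma sum_list_squares_le: "(\<Sum>b\<leftarrow>beta. b\<^sup>2) \<le> (sum_list beta :: nat)\<^sup>2"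
  by (induction beta) (auto simp: power2_sum)

lemma int_sum_list_nth: "int (sum_list xs) = (\<Sum>i<length xs. int (xs ! i))"
  by (induction xs) (simp_all add: sum.lessThan_Suc_shift del: sum.lessThan_Suc)

lemma int_sum_list_squares_nth: "int (\<Sum>b\<leftarrow>xs. b\<^sup>2) = (\<Sum>i<length xs. (int (xs ! i))\<^sup>2)"
  by (induction xs) (simp_all add: sum.lessThan_Suc_shift del: sum.lessThan_Suc)

lemma hprod_nth: "hprod xs = (\<Prod>i<length xs. hsym (int (xs ! i)))"
  by (induction xs) (simp_all add: hprod_def prod.lessThan_Suc_shift del: prod.lessThan_Suc)

lemma hprod_mset_cong:
  assumes "mset xs = mset ys" shows "hprod xs = hprod ys"
proof -
  have "hprod zs = prod_mset (image_mset (\<lambda>b. hsym (int b)) (mset zs))" for zs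
    by (simp only: hprod_def mset_map[symmetric] prod_mset_prod_list)
  with assms show ?thesis by simp
qed

lemma sum_list_mset_cong:
  fixes f :: "'a \<Rightarrow> 'b::comm_monoid_add"
  assumes "mset xs = mset ys" shows "(\<Sum>x\<leftarrow>xs. f x) = (\<Sum>x\<leftarrow>ys. f x)"
proof -
  have "(\<Sum>x\<leftarrow>zs. f x) = sum_mset (image_mset f (mset zs))" for zs
    by (simp only: mset_map[symmetric] sum_mset_sum_list)
  with assms show ?thesis by simp
qed

text \<open>
  In the expansion of the determinant \<open>s\<^sub>\<lambda>\<close> every term other than \<open>h\<^sub>\<lambda>\<close> has indices with the same sum and a
  larger sum of squares, which is bounded by the square of the sum.
\<close>

lemma lin_span_schur_hprod: "lin_span (schur ` Collect is_partition) (hprod beta)"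
proof (induction "(sum_list beta)\<^sup>2 - (\<Sum>b\<leftarrow>beta. b\<^sup>2)" arbitrary: beta rule: less_induct)
  case less
  let ?S = "schur ` Collect is_partition"
  \<comment> \<open>Parts 0 contribute h_0 = 1 and the order of factors is immaterial, so product,
    sum and sum of squares are those of \<open>beta\<close>.\<close>
  define lam where "lam = rev (sort (filter (\<lambda>b. b \<noteq> 0) beta))"
  define n where "n = length lam"
  have part: "is_partition lam"
    by (auto simp: is_partition_def lam_def sorted_wrt_rev)
  have mset: "mset lam = mset (filter (\<lambda>b. b \<noteq> 0) beta)"
    by (simp add: lam_def)
  have filter: "hprod (filter (\<lambda>b. b \<noteq> 0) beta) = hprod beta"
    "sum_list (filter (\<lambda>b. b \<noteq> 0) beta) = sum_list beta"
    "(\<Sum>b\<leftarrow>filter (\<lambda>b. b \<noteq> 0) beta. b\<^sup>2) = (\<Sum>b\<leftarrow>beta. b\<^sup>2)"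
    by (induction beta) (auto simp: hprod_def)
  have hprod: "hprod lam = hprod beta"
    using hprod_mset_cong[OF mset] filter(1) by simp
  have sum: "sum_list lam = sum_list beta"
    using sum_list_mset_cong[OF mset, of "\<lambda>b. b"] filter(2) by simp
  have sq: "(\<Sum>b\<leftarrow>lam. b\<^sup>2) = (\<Sum>b\<leftarrow>beta. b\<^sup>2)"
    using sum_list_mset_cong[OF mset, of "\<lambda>b. b\<^sup>2"] filter(3) by simp
  let ?a = "\<lambda>p i. int (lam ! i) - int i + int (p i)"
  let ?t = "\<lambda>p. signof p * (\<Prod>i<n. hsym (?a p i))"
  \<comment> \<open>A negative index makes the product vanish; otherwise the indices form the list
    \<open>gam\<close>, to which the induction hypothesis applies.\<close>
  have other: "lin_span ?S (?t p)" if p: "p permutes {..<n}" "p \<noteq> id" for p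
  proof (cases "\<exists>i<n. ?a p i < 0")
    case True
    then obtain i where "i < n" "?a p i < 0" by blast
    then have "(\<Prod>i<n. hsym (?a p i)) = 0" by (intro prod_zero bexI[of _ i]) auto
    then show ?thesis by (simp only: mult_zero_right lin_span_0)
  next
    case False
    define gam where "gam = map (\<lambda>i. nat (?a p i)) [0..<n]"
    have len: "length gam = n" by (simp add: gam_def)
    have nth: "int (gam ! i) = ?a p i" if "i < n" for i
    proof -
      have "0 \<le> ?a p i" using False that by (meson not_less)
      thus ?thesis using that by (simp add: gam_def)
    qed
    have prod: "(\<Prod>i<n. hsym (?a p i)) = hprod gam"
      unfolding hprod_nth len by (rule prod.cong) (auto simp: nth)
    have "int (sum_list gam) = (\<Sum>i<n. ?a p i)"
      unfolding int_sum_list_nth len by (rule sum.cong) (auto simp: nth)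
    also have "\<dots> = (\<Sum>i<n. int (lam ! i)) - (\<Sum>i<n. int i) + (\<Sum>i<n. int (p i))"
      by (simp only: sum.distrib sum_subtractf)
    also have "(\<Sum>i<n. int (p i)) = (\<Sum>i<n. int i)"
      using sum.permute[OF p(1), of int] by (simp only: comp_def)
    also have "(\<Sum>i<n. int (lam ! i)) - (\<Sum>i<n. int i) + (\<Sum>i<n. int i) = int (sum_list lam)"
      unfolding int_sum_list_nth n_def by simp
    finally have sum': "sum_list gam = sum_list beta" using sum by simp
    have "int (\<Sum>b\<leftarrow>lam. b\<^sup>2) = (\<Sum>i<n. (int (lam ! i))\<^sup>2)"
      unfolding n_def by (rule int_sum_list_squares_nth)
    also have "\<dots> < (\<Sum>i<n. (?a p i)\<^sup>2)"
      by (rule sum_permuted_squares_less[OF _ p])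
         (use part in \<open>auto simp: is_partition_def n_def sorted_wrt_iff_nth_less\<close>)
    also have "\<dots> = int (\<Sum>b\<leftarrow>gam. b\<^sup>2)"
      unfolding int_sum_list_squares_nth len by (rule sum.cong) (auto simp: nth)
    finally have sq': "(\<Sum>b\<leftarrow>beta. b\<^sup>2) < (\<Sum>b\<leftarrow>gam. b\<^sup>2)" unfolding sq[symmetric] by (simp only: of_nat_less_iff)
    \<comment> \<open>The measure is a truncated difference, so its strict decrease needs the old
      sum of squares to lie below the common squared sum.\<close>
    have "lin_span ?S (hprod gam)"
      by (rule less, unfold sum', rule diff_less_mono2)
        (use sum_list_squares_le[of gam] sum' sq' in auto)
    thus ?thesis using lin_span_cst_mult[of ?S "hprod gam" "signof p"]
      by (simp only: prod cst.hom_signof)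
  qed
  have "schur lam = (\<Sum>p\<in>{p. p permutes {..<n}}. ?t p)"
  proof -
    have "p i < n" if "p permutes {..<n}" "i < n" for p i
      using permutes_in_image[OF that(1)] that(2) by simp
    moreover have "JT lam \<in> carrier_mat n n" by (simp add: JT_def n_def)
    ultimately show ?thesis unfolding schur_JT
      by (subst det_def') (auto simp: JT_def n_def atLeast0LessThan intro!: sum.cong prod.cong)
  qed
  also have "\<dots> = ?t id + (\<Sum>p\<in>{p. p permutes {..<n}} - {id}. ?t p)"
    by (rule sum.remove) (auto simp: finite_permutations permutes_id)
  also have "?t id = hprod lam"
    by (simp add: hprod_nth n_def)
  finally have expand: "schur lam = hprod beta + (\<Sum>p\<in>{p. p permutes {..<n}} - {id}. ?t p)"
    unfolding hprod .
  have "hprod beta = schur lam + - (\<Sum>p\<in>{p. p permutes {..<n}} - {id}. ?t p)"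
    unfolding expand by (simp only: add.assoc right_minus add_0_right)
  also have "lin_span ?S \<dots>"
    by (intro lin_span_add lin_span_uminus lin_span_sum other lin_span_base) (use part in auto)
  finally show ?case .
qed

lemma lin_span_schur: "lin_span (schur ` Collect is_partition) P"
  using lin_span_hprod by (rule lin_span_trans) (auto simp: lin_span_schur_hprod)

section \<open>Coordinates in the Schur basis and the adjoints of the scalar product\<close>

definition lin_comb :: "(nat list \<Rightarrow> symf) \<Rightarrow> (nat list \<Rightarrow>\<^sub>0 rat poly) \<Rightarrow> symf" where
  "lin_comb b c = (\<Sum>lam\<in>Poly_Mapping.keys c. cst (Poly_Mapping.lookup c lam) * b lam)"

lemma lin_comb_superset:
  assumes "finite A" "Poly_Mapping.keys c \<subseteq> A"
  shows "lin_comb b c = (\<Sum>lam\<in>A. cst (Poly_Mapping.lookup c lam) * b lam)"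
  unfolding lin_comb_def by (rule sum.mono_neutral_left) (use assms in \<open>auto simp: in_keys_iff\<close>)

lemma lin_comb_add: "lin_comb b (c + d) = lin_comb b c + lin_comb b d"
proof -
  let ?A = "Poly_Mapping.keys c \<union> Poly_Mapping.keys d"
  have "lin_comb b (c + d) = (\<Sum>lam\<in>?A. cst (Poly_Mapping.lookup (c + d) lam) * b lam)"
    by (rule lin_comb_superset) (use keys_add[of c d] in auto)
  also have "\<dots> = lin_comb b c + lin_comb b d"
    by (subst (1 2) lin_comb_superset[where A = ?A])
       (auto simp: lookup_add cst.hom_add distrib_right sum.distrib)
  finally show ?thesis .
qed

lemma ex_schur_coords: "\<exists>c. Poly_Mapping.keys c \<subseteq> Collect is_partition \<and> P = lin_comb schur c"
  using lin_span_schur[of P]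
proof induction
  case lin_span_0
  show ?case by (rule exI[of _ 0]) (simp add: lin_comb_def)
next
  case (lin_span_step P b a)
  then obtain c lam where c: "Poly_Mapping.keys c \<subseteq> Collect is_partition" "P = lin_comb schur c"
    and lam: "b = schur lam" "is_partition lam" by blast
  have "lin_comb schur (Poly_Mapping.single lam a) = cst a * b"
    by (simp add: lin_comb_def lam)
  moreover have "Poly_Mapping.keys (c + Poly_Mapping.single lam a) \<subseteq> Collect is_partition"
    using keys_add[of c "Poly_Mapping.single lam a"] c(1) lam(2) by (auto split: if_splits)
  ultimately show ?case using c(2)
    by (intro exI[of _ "c + Poly_Mapping.single lam a"]) (simp add: lin_comb_add)
qed

lemma pform_lin_comb_schur:
  assumes "Poly_Mapping.keys c \<subseteq> Collect is_partition" "is_partition lam"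
  shows "pform (lin_comb schur c) (schur lam) = Poly_Mapping.lookup c lam"
proof -
  have "pform (lin_comb schur c) (schur lam) = (\<Sum>mu\<in>Poly_Mapping.keys c. if mu = lam then Poly_Mapping.lookup c mu else 0)"
    unfolding lin_comb_def pform_sum_left pform_cst_left
    by (rule sum.cong) (use assms in \<open>auto simp: pform_schur\<close>)
  thus ?thesis by (simp add: sum.delta in_keys_iff)
qed

text \<open>Spanning gives existence and orthonormality gives uniqueness, since pairing with
  \<open>schur lam\<close> recovers a coefficient. Thus the definite description in
  \<open>coords\<close> is meaningful.\<close>

lemma coords_schur:
  "Poly_Mapping.keys (coords schur P) \<subseteq> Collect is_partition" "lin_comb schur (coords schur P) = P"
proof -
  have "\<exists>!c. Poly_Mapping.keys c \<subseteq> Collect is_partition \<and> P = lin_comb schur c"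
  proof (rule ex_ex1I[OF ex_schur_coords])
    fix c d assume cd: "Poly_Mapping.keys c \<subseteq> Collect is_partition \<and> P = lin_comb schur c"
      "Poly_Mapping.keys d \<subseteq> Collect is_partition \<and> P = lin_comb schur d"
    show "c = d"
    proof (rule poly_mapping_eqI)
      fix lam
      show "Poly_Mapping.lookup c lam = Poly_Mapping.lookup d lam"
      proof (cases "is_partition lam")
        case True
        then show ?thesis using cd pform_lin_comb_schur by metis
      next
        case False
        then show ?thesis using cd by (metis in_keys_iff mem_Collect_eq subsetD)
      qed
    qed
  qed
  from theI'[OF this]
  show "Poly_Mapping.keys (coords schur P) \<subseteq> Collect is_partition" "lin_comb schur (coords schur P) = P"
    by (auto simp: coords_def lin_comb_def)
qed

text \<open>Both forms make the Schur functions orthonormal, and these span.\<close>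

lemma scalar_product_eq_pform: "scalar_product P Q = pform P Q"
proof -
  have "Poly_Mapping.lookup (coords schur Q) lam = pform (schur lam) Q"
    if "lam \<in> Poly_Mapping.keys (coords schur P)" for lam
    using that coords_schur(1)[of P] pform_lin_comb_schur[OF coords_schur(1)[of Q], of lam]
    by (auto simp: coords_schur(2) pform_commute)
  hence "scalar_product P Q = pform (lin_comb schur (coords schur P)) Q"
    by (simp add: scalar_product_def lin_comb_def pform_sum_left pform_cst_left)
  thus ?thesis by (simp add: coords_schur)
qed

lemma perp_eq_padj: "perp P Q = padj P Q"
  unfolding perp_def scalar_product_eq_pform
  by (rule the_equality) (auto simp: pform_padj padj_unique)

subsection \<open>Translations and the independence of the shape\<close>

definition is_linear :: "(symf \<Rightarrow> symf) \<Rightarrow> bool" where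
  "is_linear V \<longleftrightarrow> (\<forall>P Q. V (P + Q) = V P + V Q) \<and> (\<forall>c P. V (cst c * P) = cst c * V P)"

lemma is_linear_add: "is_linear V \<Longrightarrow> V (P + Q) = V P + V Q"
  and is_linear_cst: "is_linear V \<Longrightarrow> V (cst c * P) = cst c * V P"
  by (simp_all add: is_linear_def)

lemma is_linear_comp: "is_linear V \<Longrightarrow> is_linear W \<Longrightarrow> is_linear (V \<circ> W)"
  by (simp add: is_linear_def)

lemma is_linear_0: "is_linear V \<Longrightarrow> V 0 = 0"
  using is_linear_cst[of V 0 0] by simp

lemma is_linear_sum: "is_linear V \<Longrightarrow> V (\<Sum>x\<in>A. f x) = (\<Sum>x\<in>A. V (f x))"
  by (induction A rule: infinite_finite_induct) (simp_all add: is_linear_0 is_linear_add)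

lemma is_linear_translate: "is_linear (translate c)"
  by (simp add: is_linear_def translate.hom_add translate.hom_mult)

text \<open>The weight bound leaves finitely many nonzero terms. The factor \<open>h n\<close>
  covers both \<open>Omega_perp\<close>, with h = 1, and \<open>Bernstein\<close>; allowing every
  larger M gives several arguments a common bound.\<close>

lemma Sum_any_padj:
  assumes "fps_wt_ge F"
  shows "\<exists>N. \<forall>M\<ge>N. Sum_any (\<lambda>n. h n * padj (fps_nth F n) P) = (\<Sum>n<M. h n * padj (fps_nth F n) P)"
proof -
  obtain N where N: "\<forall>n\<ge>N. \<forall>Q. wt_ge n Q \<longrightarrow> padj Q P = 0"
    using ex_padj_eq_0 by blast
  have "Sum_any (\<lambda>n. h n * padj (fps_nth F n) P) = (\<Sum>n<M. h n * padj (fps_nth F n) P)" if "M \<ge> N" for M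
  proof (rule Sum_any.expand_superset)
    show "{n. h n * padj (fps_nth F n) P \<noteq> 0} \<subseteq> {..<M}"
    proof (rule subsetI, rule ccontr)
      fix n assume n: "n \<in> {n. h n * padj (fps_nth F n) P \<noteq> 0}" "n \<notin> {..<M}"
      have "N \<le> n" using n(2) that by simp
      moreover have "wt_ge n (fps_nth F n)" using assms by (simp add: fps_wt_ge_def)
      ultimately have "padj (fps_nth F n) P = 0" using N by blast
      with n show False by simp
    qed
  qed simp
  thus ?thesis by blast
qed

lemma is_linear_Sum_any_padj:
  assumes "fps_wt_ge F"
  shows "is_linear (\<lambda>P. Sum_any (\<lambda>n. h n * padj (fps_nth F n) P))"
  unfolding is_linear_def
proof (intro conjI allI)
  let ?V = "\<lambda>P. Sum_any (\<lambda>n. h n * padj (fps_nth F n) P)"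
  fix P Q c
  note bound = Sum_any_padj[OF assms, of h]
  obtain A where A: "\<forall>M\<ge>A. ?V P = (\<Sum>n<M. h n * padj (fps_nth F n) P)"
    using bound[of P] ..
  obtain B where B: "\<forall>M\<ge>B. ?V Q = (\<Sum>n<M. h n * padj (fps_nth F n) Q)"
    using bound[of Q] ..
  obtain C where C: "\<forall>M\<ge>C. ?V (P + Q) = (\<Sum>n<M. h n * padj (fps_nth F n) (P + Q))"
    using bound[of "P + Q"] ..
  obtain D where D: "\<forall>M\<ge>D. ?V (cst c * P) = (\<Sum>n<M. h n * padj (fps_nth F n) (cst c * P))"
    using bound[of "cst c * P"] ..
  let ?M = "A + B + C + D"
  have eq: "?V P = (\<Sum>n<?M. h n * padj (fps_nth F n) P)" "?V Q = (\<Sum>n<?M. h n * padj (fps_nth F n) Q)"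
    "?V (P + Q) = (\<Sum>n<?M. h n * padj (fps_nth F n) (P + Q))"
    "?V (cst c * P) = (\<Sum>n<?M. h n * padj (fps_nth F n) (cst c * P))"
    by (rule A[rule_format] B[rule_format] C[rule_format] D[rule_format]; simp)+
  show "?V (P + Q) = ?V P + ?V Q"
    unfolding eq by (simp add: padj_add_right distrib_left sum.distrib)
  show "?V (cst c * P) = cst c * ?V P"
    unfolding eq by (simp add: padj_cst_right mult.left_commute sum_distrib_left)
qed

lemma Omega_perp_eq: "Omega_perp f P = Sum_any (\<lambda>n. 1 * padj (fps_nth (Omega (graded f)) n) P)"
  by (simp add: Omega_perp_def perp_eq_padj)

lemma fps_wt_ge_Omega_graded: "fps_wt_ge (Omega (graded f))"
  by (intro fps_wt_ge_Omega fps_wt_ge_graded)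

lemma is_linear_Omega_perp: "is_linear (Omega_perp f)"
  unfolding Omega_perp_eq[abs_def]
  by (rule is_linear_Sum_any_padj[OF fps_wt_ge_Omega_graded, of "\<lambda>_. 1"])

lemma is_linear_Bernstein: "is_linear (Bernstein r)"
proof -
  have "- (fps_X * fps_const (psum 1)) = graded (- psum 1)"
    by (simp add: graded.hom_uminus graded_psum mult.commute)
  then show ?thesis
    unfolding Bernstein_def[abs_def] perp_eq_padj
    using is_linear_Sum_any_padj[OF fps_wt_ge_Omega_graded, of "\<lambda>i. hsym (r + int i)" "- psum 1"] by simp
qed

lemma is_linear_Bernstein_seq: "is_linear (Bernstein_seq nu)"
  unfolding Bernstein_seq_def
proof (induction nu)
  case Nil
  show ?case by (simp add: is_linear_def)
next
  case (Cons r nu)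
  then show ?case using is_linear_comp[OF is_linear_Bernstein] by (simp add: comp_def)
qed

lemma is_linear_Bernstein_shape: "is_linear (Bernstein_shape d nu)"
  unfolding Bernstein_shape_def
  by (intro is_linear_comp is_linear_Omega_perp is_linear_Bernstein_seq)

text \<open>\<open>Omega\<close> turns sums into products, and adjoints of products are composed
  adjoints. What remains is to rearrange a finite double sum.\<close>

lemma Omega_perp_add: "Omega_perp (f + g) P = Omega_perp f (Omega_perp g P)"
proof -
  define F where "F = Omega (graded f)"
  define G where "G = Omega (graded g)"
  have FG: "Omega (graded (f + g)) = F * G"
    by (simp add: F_def G_def graded.hom_add Omega_add)
  have ge: "fps_wt_ge F" "fps_wt_ge G" "fps_wt_ge (F * G)"
    by (simp_all add: F_def G_def fps_wt_ge_Omega_graded fps_wt_ge_mult)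
  obtain A where A: "\<And>M. M \<ge> A \<Longrightarrow> Omega_perp f (Omega_perp g P) = (\<Sum>n<M. padj (fps_nth F n) (Omega_perp g P))"
    using Sum_any_padj[OF ge(1), of "\<lambda>_. 1" "Omega_perp g P"] by (auto simp: Omega_perp_eq F_def)
  obtain B where B: "\<And>M. M \<ge> B \<Longrightarrow> Omega_perp g P = (\<Sum>n<M. padj (fps_nth G n) P)"
    using Sum_any_padj[OF ge(2), of "\<lambda>_. 1" P] by (auto simp: Omega_perp_eq G_def)
  obtain C where C: "\<And>M. M \<ge> C \<Longrightarrow> Omega_perp (f + g) P = (\<Sum>n<M. padj (fps_nth (F * G) n) P)"
    using Sum_any_padj[OF ge(3), of "\<lambda>_. 1" P] by (auto simp: Omega_perp_eq FG)
  obtain N where N: "\<forall>n\<ge>N. \<forall>Q. wt_ge n Q \<longrightarrow> padj Q P = 0"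
    using ex_padj_eq_0 by blast
  define M where "M = A + B + C + N"
  let ?p = "\<lambda>i j. padj (fps_nth F i * fps_nth G j) P"
  have "Omega_perp f (Omega_perp g P) = (\<Sum>i<M. \<Sum>j<M. ?p i j)"
    using A[of M] B[of M] by (simp add: M_def padj_sum_right padj_mult)
  also have "\<dots> = (\<Sum>(i, j)\<in>{..<M} \<times> {..<M}. ?p i j)"
    by (simp add: sum.cartesian_product)
  \<comment> \<open>Terms of the square outside the triangle have weight at least M, hence
    annihilate P; the triangle is then regrouped by i + j into the coefficients of the
    product.\<close>
  also have "\<dots> = (\<Sum>(i, j)\<in>{(i, j). i + j < M}. ?p i j)"
  proof (rule sum.mono_neutral_right)
    show "\<forall>x\<in>{..<M} \<times> {..<M} - {(i, j). i + j < M}. (case x of (i, j) \<Rightarrow> ?p i j) = 0"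
    proof (rule ballI)
      fix x assume "x \<in> {..<M} \<times> {..<M} - {(i, j). i + j < M}"
      moreover obtain i j where x: "x = (i, j)" by (cases x)
      ultimately have "N \<le> i + j" by (simp add: M_def)
      moreover have "wt_ge (i + j) (fps_nth F i * fps_nth G j)"
        using ge by (intro wt_ge_mult) (auto simp: fps_wt_ge_def)
      ultimately have "?p i j = 0" using N by blast
      thus "(case x of (i, j) \<Rightarrow> ?p i j) = 0" by (simp add: x)
    qed
  qed auto
  also have "\<dots> = (\<Sum>n<M. \<Sum>i\<le>n. ?p i (n - i))"
    by (rule sum.triangle_reindex)
  also have "\<dots> = (\<Sum>n<M. padj (fps_nth (F * G) n) P)"
    by (simp add: fps_mult_nth padj_sum_left atLeast0AtMost)
  also have "\<dots> = Omega_perp (f + g) P"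
    using C[of M] by (simp add: M_def)
  finally show ?thesis ..
qed

text \<open>Omega[e p_j] is the exponential of the sum of j e p_n / n over the multiples n of j, so
  its adjoint adds j e to exactly those p_n.\<close>

lemma Omega_perp_psum:
  assumes "j > 0"
  shows "Omega_perp (cst [:e:] * psum j) P = translate (\<lambda>k. if j dvd k then of_nat j * e else 0) P"
  unfolding Omega_perp_def perp_eq_padj
  by (rule Sum_any_padj_eq_translate, rule Omega_nth_0, rule Omega_psum_recursion[OF assms])

section \<open>The differences between the three series\<close>

lemma schur_1: "schur [1] = psum 1"
proof -
  have "schur [1] = hsym 1"
    unfolding schur_JT by (subst det_single) (auto simp: JT_def)
  thus ?thesis using Newton_hsym[of 1] by simp
qed

lemma schur_2: "schur [2] = hsym 2"
  unfolding schur_JT by (subst det_single) (auto simp: JT_def)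

lemma schur_1_1: "schur [1, 1] = hsym 1 * hsym 1 - hsym 2"
proof -
  have "schur [1, 1] = (\<Sum>j<2. JT [1, 1] $$ (0, j) * cofactor (JT [1, 1]) 0 j)"
    unfolding schur_JT by (rule laplace_expansion_row) (auto simp: JT_def)
  also have "{..<2} = {0, 1 :: nat}" by auto
  also have "(\<Sum>j\<in>{0, 1}. JT [1, 1] $$ (0, j) * cofactor (JT [1, 1]) 0 j)
      = JT [1, 1] $$ (0, 0) * cofactor (JT [1, 1]) 0 0 + JT [1, 1] $$ (0, 1) * cofactor (JT [1, 1]) 0 1"
    by simp
  also have "cofactor (JT [1, 1]) 0 0 = hsym 1"
    unfolding cofactor_JT schur_JT by (subst det_single) (auto simp: JT_def)
  \<comment> \<open>The remaining entry, in row 1 and column 0, is h_0 = 1; the sign comes from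
    position (0, 1).\<close>
  also have "cofactor (JT [1, 1]) 0 1 = - 1"
    unfolding cofactor_def by (subst det_single) (auto simp: JT_def mat_delete_def)
  also have "JT [1, 1] $$ (0, 0) = hsym 1" by (simp add: JT_def)
  also have "JT [1, 1] $$ (0, 1) = hsym 2" by (simp add: JT_def)
  also have "hsym 1 * hsym 1 + hsym 2 * - 1 = hsym 1 * hsym 1 - hsym 2" by simp
  finally show ?thesis .
qed

lemma f_shape_Square: "f_shape Square = f_shape Vertical + psum 1"
  by (simp only: f_shape.simps schur_1 add.commute)

text \<open>Newton's identity for n = 2 and h_1 = p_1 give h_2 - (h_1^2 - h_2) = p_2.\<close>

lemma f_shape_Horizontal: "f_shape Horizontal = f_shape Vertical + psum 2"
proof -
  have h1: "hsym 1 = psum 1" using Newton_hsym[of 1] by simp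
  have "of_nat 2 * hsym (int 2) = psum 1 * hsym 1 + psum 2"
  proof -
    have "{1..2} = {1, 2 :: nat}" by auto
    thus ?thesis unfolding Newton_hsym by simp
  qed
  hence "hsym 2 + hsym 2 = hsym 1 * hsym 1 + psum 2"
    by (simp only: of_nat_numeral mult_2 flip: h1)
  hence "hsym 2 = hsym 1 * hsym 1 - hsym 2 + psum 2"
    by (simp only: diff_add_eq eq_diff_eq)
  thus ?thesis
    by (simp only: f_shape.simps schur_2 schur_1_1)
qed

section \<open>The t-analogue and translation of both alphabets\<close>

definition apply_Y :: "(symf \<Rightarrow> symf) \<Rightarrow> symf2 \<Rightarrow> symf" where
  "apply_Y V Q = (\<Sum>m\<in>Poly_Mapping.keys Q. Poly_Mapping.lookup Q m * V (pmono m))"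

lemma comm_ring_hom_cst_cst: "comm_ring_hom (\<lambda>c. cst (cst c :: symf) :: symf2)"
  by unfold_locales (simp_all add: cst.hom_add cst.hom_mult)

interpretation set_Y_to_X: comm_ring_hom set_Y_to_X
  unfolding set_Y_to_X_def by (intro comm_ring_hom_psubst comm_ring_hom_id)

interpretation sym_in_Y: comm_ring_hom sym_in_Y
  unfolding sym_in_Y_def by (intro comm_ring_hom_psubst comm_ring_hom_cst_cst)

interpretation plethysm_tXY: comm_ring_hom plethysm_tXY
  unfolding plethysm_tXY_def by (intro comm_ring_hom_psubst comm_ring_hom_cst_cst)

lemma sym_in_Y_cst: "sym_in_Y (cst c) = cst (cst c)"
  by (simp add: sym_in_Y_def psubst_cst)

lemma sym_in_Y_psum: "k > 0 \<Longrightarrow> sym_in_Y (psum k) = psum k"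
  by (simp add: sym_in_Y_def psubst_psum)

lemma sym_in_Y_pmono: "sym_in_Y (pmono m) = pmono m"
  by (simp add: sym_in_Y_def psubst_pmono monom_val_psum)

lemma set_Y_to_X_cst: "set_Y_to_X (cst c) = c"
  by (simp add: set_Y_to_X_def psubst_cst)

lemma set_Y_to_X_psum: "k > 0 \<Longrightarrow> set_Y_to_X (psum k) = psum k"
  by (simp add: set_Y_to_X_def psubst_psum)

lemma set_Y_to_X_sym_in_Y: "set_Y_to_X (sym_in_Y P) = P"
proof (rule power_sum_hom_eqI[where f = "\<lambda>P. set_Y_to_X (sym_in_Y P)" and g = "\<lambda>P. P"])
  show "comm_ring_hom (\<lambda>P. set_Y_to_X (sym_in_Y P))"
    by unfold_locales (simp_all add: sym_in_Y.hom_add sym_in_Y.hom_mult set_Y_to_X.hom_add set_Y_to_X.hom_mult)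
qed (simp_all add: comm_ring_hom_id sym_in_Y_cst sym_in_Y_psum set_Y_to_X_cst set_Y_to_X_psum)

text \<open>Setting Y to X undoes \<open>sym_in_Y\<close>, so acting in Y and identifying the
  alphabets merge into one map.\<close>

lemma t_analogue_eq: "t_analogue V P = apply_Y V (plethysm_tXY P)"
  by (simp add: t_analogue_def act_in_Y_def apply_Y_def set_Y_to_X.hom_sum set_Y_to_X.hom_mult
    set_Y_to_X_cst set_Y_to_X_sym_in_Y)

lemma apply_Y_superset:
  assumes "finite A" "Poly_Mapping.keys Q \<subseteq> A"
  shows "apply_Y V Q = (\<Sum>m\<in>A. Poly_Mapping.lookup Q m * V (pmono m))"
  unfolding apply_Y_def by (rule sum.mono_neutral_left) (use assms in \<open>auto simp: in_keys_iff\<close>)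

lemma apply_Y_add: "apply_Y V (Q + R) = apply_Y V Q + apply_Y V R"
proof -
  let ?A = "Poly_Mapping.keys Q \<union> Poly_Mapping.keys R"
  have "apply_Y V (Q + R) = (\<Sum>m\<in>?A. Poly_Mapping.lookup (Q + R) m * V (pmono m))"
    by (rule apply_Y_superset) (use keys_add[of Q R] in auto)
  also have "\<dots> = apply_Y V Q + apply_Y V R"
    by (subst (1 2) apply_Y_superset[where A = ?A]) (auto simp: lookup_add distrib_right sum.distrib)
  finally show ?thesis .
qed

lemma apply_Y_single: "apply_Y V (Poly_Mapping.single m a) = a * V (pmono m)"
  by (simp add: apply_Y_def)

text \<open>\<open>apply_Y\<close> evaluates V on monomials only; linearity of V extends this to
  every symmetric function of Y.\<close>

lemma apply_Y_cst_mult_sym_in_Y: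
  assumes "is_linear V"
  shows "apply_Y V (cst a * sym_in_Y P) = a * V P"
proof (induction P rule: poly_mapping_add_induct)
  case (single m c)
  have "sym_in_Y (Poly_Mapping.single m c) = Poly_Mapping.single m (cst c)"
    using cst_mult_pmono[of c m] by (metis sym_in_Y.hom_mult sym_in_Y_cst sym_in_Y_pmono cst_mult_pmono)
  then show ?case using is_linear_cst[OF assms, of c "pmono m"]
    by (simp add: cst_mult_single apply_Y_single mult.assoc cst_mult_pmono)
qed (simp add: sym_in_Y.hom_add distrib_left apply_Y_add is_linear_add[OF assms])

text \<open>The same constants are added in both alphabets: \<open>translate c\<close> on the
  coefficients treats X, and the substitution treats Y.\<close>

definition translate_XY :: "(nat \<Rightarrow> rat) \<Rightarrow> symf2 \<Rightarrow> symf2" where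
  "translate_XY c = psubst (\<lambda>x. cst (translate c x)) (\<lambda>k. psum k + cst (cst [:c k:]))"

interpretation translate_XY: comm_ring_hom "translate_XY c"
  unfolding translate_XY_def
  by (intro comm_ring_hom_psubst, unfold_locales)
     (simp_all add: translate.hom_add translate.hom_mult cst.hom_add cst.hom_mult)

lemma translate_XY_cst: "translate_XY c (cst a) = cst (translate c a)"
  by (simp add: translate_XY_def psubst_cst)

lemma translate_XY_psum: "k > 0 \<Longrightarrow> translate_XY c (psum k) = psum k + cst (cst [:c k:])"
  by (simp add: translate_XY_def psubst_psum)

lemma translate_XY_sym_in_Y: "translate_XY c (sym_in_Y P) = sym_in_Y (translate c P)"
proof (rule power_sum_hom_eqI[where f = "\<lambda>P. translate_XY c (sym_in_Y P)" and g = "\<lambda>P. sym_in_Y (translate c P)"])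
  show "comm_ring_hom (\<lambda>P. translate_XY c (sym_in_Y P))" "comm_ring_hom (\<lambda>P. sym_in_Y (translate c P))"
    by (unfold_locales; simp add: sym_in_Y.hom_add sym_in_Y.hom_mult translate_XY.hom_add translate_XY.hom_mult
        translate.hom_add translate.hom_mult)+
qed (simp_all add: sym_in_Y_cst sym_in_Y_psum translate_XY_cst translate_XY_psum translate_psum sym_in_Y.hom_add)

text \<open>On p_k, the constant c_k is added to p_k[X] and to p_k[Y], whose coefficients t^k and 1
  - t^k have sum 1; so exactly c_k is added to the image.\<close>

lemma translate_XY_plethysm: "translate_XY c (plethysm_tXY P) = plethysm_tXY (translate c P)"
proof (rule power_sum_hom_eqI[where f = "\<lambda>P. translate_XY c (plethysm_tXY P)" and g = "\<lambda>P. plethysm_tXY (translate c P)"])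
  show "comm_ring_hom (\<lambda>P. translate_XY c (plethysm_tXY P))" "comm_ring_hom (\<lambda>P. plethysm_tXY (translate c P))"
    by (unfold_locales; simp add: plethysm_tXY.hom_add plethysm_tXY.hom_mult translate_XY.hom_add translate_XY.hom_mult
        translate.hom_add translate.hom_mult)+
  have cst: "plethysm_tXY (cst x) = cst (cst x)" for x
    by (simp add: plethysm_tXY_def psubst_cst)
  thus "translate_XY c (plethysm_tXY (cst x)) = plethysm_tXY (translate c (cst x))" for x
    by (simp add: translate_XY_cst)
  fix k :: nat assume k: "k > 0"
  define a d :: symf2 where "a = cst (cst (tvar ^ k))" and "d = cst (cst [:c k:])"
  have pk: "plethysm_tXY (psum k) = a * cst (psum k) + (1 - a) * psum k"
    using k by (simp add: plethysm_tXY_def psubst_psum)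
      (simp only: a_def cst.hom_mult cst.hom_minus cst.hom_one One_nat_def)
  have "translate_XY c a = a"
    unfolding a_def translate_XY_cst translate_cst ..
  hence "translate_XY c (plethysm_tXY (psum k)) = a * (cst (psum k) + d) + (1 - a) * (psum k + d)"
    using k by (simp add: pk translate_XY.hom_add translate_XY.hom_mult translate_XY.hom_minus translate_XY_cst
      translate_XY_psum translate_psum cst.hom_add d_def)
  also have "\<dots> = plethysm_tXY (psum k) + d"
    by (simp add: pk algebra_simps)
  also have "\<dots> = plethysm_tXY (translate c (psum k))"
    using k by (simp add: translate_psum plethysm_tXY.hom_add cst d_def)
  finally show "translate_XY c (plethysm_tXY (psum k)) = plethysm_tXY (translate c (psum k))" .
qed

text \<open>On a term a p^m in Y, the conjugated operator followed by the translation by c yields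
  T(a) V(T(p^m)), where T is that translation. This is V acting on the term translated in both
  alphabets.\<close>

lemma t_analogue_conj_translate:
  assumes V: "is_linear V" and inverse: "\<And>P. translate c (translate c' P) = P" "\<And>P. translate c' (translate c P) = P"
  shows "t_analogue (translate c' \<circ> V \<circ> translate c) P = translate c' (t_analogue V (translate c P))"
proof -
  have "translate c (apply_Y (translate c' \<circ> V \<circ> translate c) Q) = apply_Y V (translate_XY c Q)" for Q
  proof (induction Q rule: poly_mapping_add_induct)
    case (single m a)
    have "translate_XY c (Poly_Mapping.single m a) = cst (translate c a) * sym_in_Y (translate c (pmono m))"
      by (simp add: translate_XY.hom_mult translate_XY_cst translate_XY_sym_in_Y 
         flip: cst_mult_pmono[of a] sym_in_Y_pmono)
    then show ?case
      by (simp add: apply_Y_single translate.hom_mult inverse apply_Y_cst_mult_sym_in_Y[OF V])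
  qed (simp add: apply_Y_add translate.hom_add translate_XY.hom_add)
  hence "translate c (t_analogue (translate c' \<circ> V \<circ> translate c) P) = t_analogue V (translate c P)"
    by (simp add: t_analogue_eq translate_XY_plethysm)
  thus ?thesis using inverse(2) by metis
qed

text \<open>An injective linear map preserves and reflects linear relations, so the two definite
  descriptions have the same predicate.\<close>

lemma coords_linear_image:
  assumes U: "is_linear U" "inj U"
  shows "coords (\<lambda>lam. U (b lam)) (U P) = coords b P"
proof -
  have "U P = (\<Sum>lam\<in>Poly_Mapping.keys c. cst (Poly_Mapping.lookup c lam) * U (b lam)) \<longleftrightarrow>
      P = (\<Sum>lam\<in>Poly_Mapping.keys c. cst (Poly_Mapping.lookup c lam) * b lam)" for c
  proof -
    have "(\<Sum>lam\<in>Poly_Mapping.keys c. cst (Poly_Mapping.lookup c lam) * U (b lam)) =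
        U (\<Sum>lam\<in>Poly_Mapping.keys c. cst (Poly_Mapping.lookup c lam) * b lam)"
      by (simp add: is_linear_sum[OF U(1)] is_linear_cst[OF U(1)])
    thus ?thesis using U(2) by (simp add: inj_eq)
  qed
  thus ?thesis by (simp add: coords_def)
qed

lemma d_coeff_eq_Vertical:
  assumes j: "j > 0" and f: "f_shape d = f_shape Vertical + psum j"
  shows "d_coeff d lam R = d_coeff Vertical lam R"
proof -
  \<comment> \<open>These are the constants of \<open>Omega_perp_psum\<close> for e = 1; e = -1
    gives their negatives and hence the inverse translation.\<close>
  define c where "c = (\<lambda>k. if j dvd k then of_nat j else 0 :: rat)"
  define T T' where "T = translate c" and "T' = translate (\<lambda>k. - c k)"
  have inv: "T (T' P) = P" "T' (T P) = P" for P
    by (simp_all add: T_def T'_def translate_translate translate_zero)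
  have "[:- 1:] = (- 1 :: rat poly)" by (simp add: one_pCons)
  hence psum: "psum j = cst [:1:] * (psum j :: symf)" "- psum j = cst [:- 1:] * (psum j :: symf)"
    by (simp_all add: cst.hom_uminus flip: one_pCons)
  have pos: "Omega_perp (psum j) P = T P" for P
    using Omega_perp_psum[OF j, of 1 P] unfolding psum(1)[symmetric] mult_1_right T_def c_def .
  have neg: "Omega_perp (- psum j) P = T' P" for P
  proof -
    have "(\<lambda>k. if j dvd k then of_nat j * - 1 else 0) = (\<lambda>k. - c k)"
      by (auto simp: c_def)
    thus ?thesis
      using Omega_perp_psum[OF j, of "- 1" P] unfolding psum(2)[symmetric] T'_def by simp
  qed
  have Omega_pos: "Omega_perp (f_shape d) P = Omega_perp (f_shape Vertical) (T P)" for P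
    unfolding f Omega_perp_add pos ..
  have "- f_shape d = - psum j + - f_shape Vertical" unfolding f by simp
  hence Omega_neg: "Omega_perp (- f_shape d) P = T' (Omega_perp (- f_shape Vertical) P)" for P
    by (simp only: Omega_perp_add neg)
  have "Bernstein_shape d nu = T' \<circ> Bernstein_shape Vertical nu \<circ> T" for nu
    by (rule ext) (simp add: Bernstein_shape_def Omega_pos Omega_neg)
  hence t: "t_Bernstein_shape d nu P = T' (t_Bernstein_shape Vertical nu (T P))" for nu P
    unfolding t_Bernstein_shape_def T_def T'_def
    by (simp add: t_analogue_conj_translate[OF is_linear_Bernstein_shape] inv[unfolded T_def T'_def])
  \<comment> \<open>Between consecutive operators T and T' cancel, and T' fixes the starting value
    1, so a single T' remains in front.\<close>
  have "foldr (\<lambda>Rj. t_Bernstein_shape d (map int Rj)) R 1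
      = T' (foldr (\<lambda>Rj. t_Bernstein_shape Vertical (map int Rj)) R 1)"
    by (induction R) (simp_all add: T'_def t[unfolded T'_def] inv[unfolded T'_def])
  moreover have "schur_shape d = (\<lambda>lam. T' (schur_shape Vertical lam))"
    by (rule ext) (simp add: schur_shape_def Omega_neg)
  moreover have "inj T'" by (rule inj_on_inverseI[of _ T]) (rule inv)
  moreover have "is_linear T'" by (simp add: T'_def is_linear_translate)
  ultimately show ?thesis
    by (simp add: d_coeff_def coords_linear_image)
qed

theorem theorem23:
  fixes lam :: "nat list" and R :: "nat list list"
  assumes "is_partition lam"
    and "\<forall>Rj\<in>set R. is_partition Rj"
  shows "d_coeff Square lam R = d_coeff Vertical lam R
    \<and> d_coeff Vertical lam R = d_coeff Horizontal lam R"
  using d_coeff_eq_Vertical[of 1, OF _ f_shape_Square] d_coeff_eq_Vertical[of 2, OF _ f_shape_Horizontal]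
  by simp

end
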